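(* Let $\Omega$, $B$, $\phi$, $\epsilon>0$, $D$ and $d$ be as in the context. Consider the bilinear form on $H^1_0(B)$ $$a(u,v) := \int_B \phi D\,\nabla u\cdot\nabla(\phi v) + D\,\big(\nabla\phi\cdot\nabla(\phi u)\big)\, v+\frac{D}{\epsilon^{2}}(1-\phi)\,u v\;dx .$$ Then $a$ is not symmetric, but it is coercive: there is a constant $C>0$ such that $a(u,u)\ge C\|u\|^2$ for all $u\in H^1_0(B)$, with respect to the norm $$\|u\|^2 := \int_B |\nabla(\phi u)|^2+\epsilon^{-2}(1-\phi)|u|^2\;dx .$$
   Context: $\Omega\subset\mathbb{R}^n$ is a nonempty, sufficiently smooth bounded domain, and $B\supset\Omega$ is a larger bounded domain. $r$ is the signed distance function of $\Omega$ (negative in $\Omega$, positive outside, $|\nabla r|=1$ almost everywhere). For a fixed parameter $\epsilon>0$ the phase-field function is $$\phi(x)=\tfrac12\left(1-\tanh\left(\tfrac{3r(x)}{\epsilon}\right)\right),\quad x\in B,$$ so $\phi$ takes values in $(0,1)$ and $\nabla\phi=-\frac{6}{\epsilon}\phi(1-\phi)\nabla r$. $D:B\to\mathbb{R}$ is a bounded scalar function with $D(x)\ge d>0$ for a constant $d$. *)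

theory Defs
  imports "HOL-Analysis.Analysis"
begin

section \<open>Domains, classical smoothness and test functions\<close>

definition is_domain :: "'a::euclidean_space set \<Rightarrow> bool" where
  "is_domain S \<longleftrightarrow> open S \<and> connected S \<and> S \<noteq> {}"

definition gradient :: "('a::euclidean_space \<Rightarrow> real) \<Rightarrow> 'a \<Rightarrow> 'a" where
  "gradient f x = (\<Sum>b\<in>Basis. frechet_derivative f (at x) b *\<^sub>R b)"

text \<open>
  The class of \<open>k\<close> times continuously differentiable functions on an open set \<open>S\<close>:
  \<open>f\<close> is \<open>C\<^sup>k\<^sup>+\<^sup>1\<close> iff it is differentiable and all its partial derivatives are \<open>C\<^sup>k\<close>.
\<close>

primrec Ck_on :: "nat \<Rightarrow> 'a::euclidean_space set \<Rightarrow> ('a \<Rightarrow> real) \<Rightarrow> bool" where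
  "Ck_on 0 S f \<longleftrightarrow> continuous_on S f"
| "Ck_on (Suc k) S f \<longleftrightarrow>
     (\<forall>x\<in>S. f differentiable (at x)) \<and>
     (\<forall>b\<in>Basis. Ck_on k S (\<lambda>x. frechet_derivative f (at x) b))"

definition test_functions :: "'a::euclidean_space set \<Rightarrow> ('a \<Rightarrow> real) set" where
  "test_functions B =
     {\<psi>. (\<forall>k. Ck_on k UNIV \<psi>) \<and>
         compact (closure {x. \<psi> x \<noteq> 0}) \<and> closure {x. \<psi> x \<noteq> 0} \<subseteq> B}"

text \<open>
  \<open>S\<close> is locally the strict sublevel set of a \<open>C\<^sup>1\<close> function with nonvanishing gradient; by the
  implicit function theorem this says that \<open>S\<close> lies locally on one side of a \<open>C\<^sup>1\<close> graph.
\<close>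

definition C1_boundary :: "'a::euclidean_space set \<Rightarrow> bool" where
  "C1_boundary S \<longleftrightarrow>
     (\<forall>x\<in>frontier S. \<exists>U \<rho>. open U \<and> x \<in> U \<and> Ck_on 1 U \<rho> \<and>
        (\<forall>y\<in>U. gradient \<rho> y \<noteq> 0) \<and> S \<inter> U = {y\<in>U. \<rho> y < 0})"

section \<open>Sobolev spaces\<close>

text \<open>
  Elements of Lebesgue and Sobolev spaces are represented by total functions, of which only the
  values on \<open>B\<close> matter; functions that agree almost everywhere on \<open>B\<close> are not identified.
\<close>

definition locally_integrable ::
    "'a::euclidean_space set \<Rightarrow> ('a \<Rightarrow> 'b::euclidean_space) \<Rightarrow> bool" where
  "locally_integrable B f \<longleftrightarrow> (\<forall>K. compact K \<and> K \<subseteq> B \<longrightarrow> integrable (lebesgue_on K) f)"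

definition L2 :: "'a::euclidean_space set \<Rightarrow> ('a \<Rightarrow> 'b::euclidean_space) set" where
  "L2 B = {f \<in> borel_measurable (lebesgue_on B). integrable (lebesgue_on B) (\<lambda>x. (norm (f x))\<^sup>2)}"

definition has_weak_gradient ::
    "'a::euclidean_space set \<Rightarrow> ('a \<Rightarrow> real) \<Rightarrow> ('a \<Rightarrow> 'a) \<Rightarrow> bool" where
  "has_weak_gradient B f g \<longleftrightarrow>
     locally_integrable B f \<and> locally_integrable B g \<and>
     (\<forall>\<psi>\<in>test_functions B.
        (LINT x|lebesgue_on B. f x *\<^sub>R gradient \<psi> x) = - (LINT x|lebesgue_on B. \<psi> x *\<^sub>R g x))"

text \<open>Determined almost everywhere on an open set \<open>B\<close> whenever a weak gradient exists.\<close>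

definition weak_grad :: "'a::euclidean_space set \<Rightarrow> ('a \<Rightarrow> real) \<Rightarrow> 'a \<Rightarrow> 'a" where
  "weak_grad B f = (SOME g. has_weak_gradient B f g)"

definition H1 :: "'a::euclidean_space set \<Rightarrow> ('a \<Rightarrow> real) set" where
  "H1 B = {u \<in> L2 B. \<exists>g\<in>L2 B. has_weak_gradient B u g}"

text \<open>The closure of the test functions in the \<open>H\<^sup>1\<close> norm.\<close>

definition H10 :: "'a::euclidean_space set \<Rightarrow> ('a \<Rightarrow> real) set" where
  "H10 B =
     {u \<in> H1 B. \<exists>\<psi>. (\<forall>k::nat. \<psi> k \<in> test_functions B) \<and>
        (\<lambda>k. LINT x|lebesgue_on B.
               (u x - \<psi> k x)\<^sup>2 + (norm (weak_grad B u x - gradient (\<psi> k) x))\<^sup>2) \<longlonglongrightarrow> 0}"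

section \<open>The diffuse domain bilinear form\<close>

definition signed_distance :: "'a::euclidean_space set \<Rightarrow> 'a \<Rightarrow> real" where
  "signed_distance \<Omega> x =
     (if x \<in> \<Omega> then - infdist x (frontier \<Omega>) else infdist x (frontier \<Omega>))"

definition phase_field :: "'a::euclidean_space set \<Rightarrow> real \<Rightarrow> 'a \<Rightarrow> real" where
  "phase_field \<Omega> \<epsilon> x = (1 - tanh (3 * signed_distance \<Omega> x / \<epsilon>)) / 2"

definition dd_form ::
    "'a::euclidean_space set \<Rightarrow> ('a \<Rightarrow> real) \<Rightarrow> ('a \<Rightarrow> real) \<Rightarrow> real \<Rightarrow>
     ('a \<Rightarrow> real) \<Rightarrow> ('a \<Rightarrow> real) \<Rightarrow> real" where
  "dd_form B \<phi> D \<epsilon> u v =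
     (LINT x|lebesgue_on B.
        \<phi> x * D x * (weak_grad B u x \<bullet> weak_grad B (\<lambda>y. \<phi> y * v y) x)
        + D x * (weak_grad B \<phi> x \<bullet> weak_grad B (\<lambda>y. \<phi> y * u y) x) * v x
        + D x / \<epsilon>\<^sup>2 * (1 - \<phi> x) * u x * v x)"

definition dd_norm_sq ::
    "'a::euclidean_space set \<Rightarrow> ('a \<Rightarrow> real) \<Rightarrow> real \<Rightarrow> ('a \<Rightarrow> real) \<Rightarrow> real" where
  "dd_norm_sq B \<phi> \<epsilon> u =
     (LINT x|lebesgue_on B.
        (norm (weak_grad B (\<lambda>y. \<phi> y * u y) x))\<^sup>2 + (1 - \<phi> x) * \<bar>u x\<bar>\<^sup>2 / \<epsilon>\<^sup>2)"

end

theory Submission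
  imports Defs "HOL-Computational_Algebra.Polynomial"
begin

text \<open>
  The product rule \<open>\<nabla>(\<phi>u) = \<phi>\<nabla>u + u\<nabla>\<phi>\<close> turns the first two terms of \<open>a(u,u)\<close> into \<open>D |\<nabla>(\<phi>u)|\<^sup>2\<close>, so
  \<open>a\<close> is coercive with constant \<open>d\<close>; and \<open>a(v,u) - a(u,v) = 2 \<integral> D\<phi> u\<^sup>2 \<partial>\<^sub>b\<phi>\<close> for \<open>v = x\<^sub>b u\<close>, so symmetry
  would force \<open>\<nabla>\<phi> = 0\<close> almost everywhere.

  The point is to show that \<open>\<phi>\<close> has a bounded, almost everywhere nonzero weak gradient without
  Rademacher's theorem. Off the null set \<open>\<partial>\<Omega>\<close>, \<open>\<phi>\<close> is a smooth function of \<open>dist(x, \<partial>\<Omega>)\<^sup>2\<close>, and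
  \<open>|x|\<^sup>2 - dist(x, \<partial>\<Omega>)\<^sup>2\<close> is convex with subgradient \<open>2 y\<close>, where \<open>y\<close> is a nearest boundary point;
  hence all partial derivatives exist almost everywhere and \<open>\<nabla>\<phi>\<close> is a nonzero multiple of \<open>x - y\<close>.
  Dominated convergence of difference quotients identifies this gradient as a weak one.
\<close>

text \<open>In \<open>a(u,u)\<close> no derivative falls on \<open>D\<close>, so boundedness and
  measurability of \<open>D\<close> are enough and only its lower bound enters the constant. The
  delicate point is \<open>weak_grad\<close>: as a \<open>SOME\<close> choice it carries no
  information until some weak gradient has been exhibited, which is why
  \<open>\<nabla>\<phi>\<close> and \<open>\<nabla>(\<phi>u)\<close> must be constructed. The
  squared distance is taken because |x|^2 - dist(x,F)^2 is the supremum of the affine functions 2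
  x.y - |y|^2 over y in F, hence convex on the whole space, whereas the distance itself has a kink
  along F. Convexity reduces differentiability almost everywhere to the countability of the
  discontinuities of a monotone function on a line. Regularity of the boundary makes F a null set;
  on a frontier of positive measure nothing would keep \<open>\<nabla>\<phi>\<close> away from zero.
  The pair u, x_b u leaves the weight u^2 in the asymmetry, so the fundamental lemma is set up for
  squares of test functions.\<close>

section \<open>The gradient vector of a differentiable function\<close>

lemma gradient_inner:
  fixes f :: "'a::euclidean_space \<Rightarrow> real"
  assumes "f differentiable (at x)"
  shows "gradient f x \<bullet> h = frechet_derivative f (at x) h"
proof -
  interpret linear "frechet_derivative f (at x)"
    using assms frechet_derivative_works has_derivative_linear by blast
  have "frechet_derivative f (at x) h = frechet_derivative f (at x) (\<Sum>b\<in>Basis. (h \<bullet> b) *\<^sub>R b)"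
    by (simp add: euclidean_representation)
  also have "\<dots> = gradient f x \<bullet> h"
    by (simp add: gradient_def sum scale inner_sum_left mult.commute inner_commute[of h])
  finally show ?thesis by simp
qed

lemma has_derivative_gradient:
  fixes f :: "'a::euclidean_space \<Rightarrow> real"
  assumes "f differentiable (at x)"
  shows "(f has_derivative (\<lambda>h. gradient f x \<bullet> h)) (at x)"
proof -
  have "(\<lambda>h. gradient f x \<bullet> h) = frechet_derivative f (at x)"
    using gradient_inner[OF assms] by auto
  then show ?thesis using assms frechet_derivative_works by metis
qed

lemma gradient_eqI:
  fixes f :: "'a::euclidean_space \<Rightarrow> real"
  assumes "(f has_derivative (\<lambda>h. g \<bullet> h)) (at x)"
  shows "gradient f x = g"
  using assms
  by (metis (mono_tags) differentiableI euclidean_eqI frechet_derivative_at gradient_inner)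

lemma gradient_mult:
  fixes f g :: "'a::euclidean_space \<Rightarrow> real"
  assumes "f differentiable (at x)" "g differentiable (at x)"
  shows "gradient (\<lambda>x. f x * g x) x = f x *\<^sub>R gradient g x + g x *\<^sub>R gradient f x"
proof (rule gradient_eqI)
  show "((\<lambda>x. f x * g x) has_derivative (\<lambda>h. (f x *\<^sub>R gradient g x + g x *\<^sub>R gradient f x) \<bullet> h)) (at x)"
    using has_derivative_mult[OF has_derivative_gradient[OF assms(1)] has_derivative_gradient[OF assms(2)]]
    by (simp add: inner_add_left mult.commute)
qed

section \<open>Smooth functions\<close>

definition smooth :: "('a::euclidean_space \<Rightarrow> real) \<Rightarrow> bool" where
  "smooth f \<longleftrightarrow> (\<forall>k. Ck_on k UNIV f)"

text \<open>Lets an explicit derivative stand in for the chosen \<open>frechet_derivative\<close>;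
  smoothness of a family closed under differentiation then follows by induction over
  \<open>k\<close>.\<close>

lemma Ck_on_SucI:
  assumes "\<And>x. (f has_derivative f' x) (at x)"
    and "\<And>b. b \<in> Basis \<Longrightarrow> Ck_on k UNIV (\<lambda>x. f' x b)"
  shows "Ck_on (Suc k) UNIV f"
proof -
  have "frechet_derivative f (at x) = f' x" for x
    using assms(1) frechet_derivative_at by metis
  then show ?thesis
    using assms by (auto intro: differentiableI)
qed

lemma Ck_on_Suc_imp: "Ck_on (Suc k) UNIV f \<Longrightarrow> Ck_on k UNIV f"
proof (induction k arbitrary: f)
  case 0
  then show ?case
    by (auto intro!: differentiable_imp_continuous_on simp: differentiable_on_def)
next
  case (Suc k)
  then show ?case by auto
qed

lemma smoothD:
  assumes "smooth f"
  shows "f differentiable (at x)" "continuous_on S f" "continuous_on S (gradient f)"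
proof -
  have 2: "Ck_on (Suc 0) UNIV f" "continuous_on UNIV f"
    using assms unfolding smooth_def by (metis Ck_on.simps)+
  then show d: "f differentiable (at x)" for x by simp
  show "continuous_on S f" using 2 continuous_on_subset by blast
  have "continuous_on UNIV (gradient f)"
    unfolding gradient_def using 2(1) by (intro continuous_intros) auto
  then show "continuous_on S (gradient f)" using continuous_on_subset by blast
qed

lemma smooth_const: "smooth (\<lambda>x. c)"
proof -
  have "Ck_on k UNIV (\<lambda>x::'a. c)" for k c
  proof (induction k arbitrary: c)
    case (Suc k)
    show ?case by (rule Ck_on_SucI[OF has_derivative_const Suc])
  qed simp
  then show ?thesis by (simp add: smooth_def)
qed

lemma smooth_inner: "smooth (\<lambda>x. x \<bullet> v)"
proof -
  have "Ck_on k UNIV (\<lambda>x::'a. x \<bullet> v)" for k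
  proof (cases k)
    case (Suc j)
    have "Ck_on (Suc j) UNIV (\<lambda>x::'a. x \<bullet> v)"
      using smooth_const
      by (intro Ck_on_SucI[where f'="\<lambda>x h. h \<bullet> v"] derivative_eq_intros refl) (auto simp: smooth_def)
    then show ?thesis by (simp only: Suc)
  qed (auto intro: continuous_intros)
  then show ?thesis by (simp add: smooth_def)
qed

lemma Ck_on_add: "Ck_on k UNIV f \<Longrightarrow> Ck_on k UNIV g \<Longrightarrow> Ck_on k UNIV (\<lambda>x. f x + g x)"
proof (induction k arbitrary: f g)
  case (Suc k)
  show ?case
  proof (rule Ck_on_SucI)
    show "((\<lambda>x. f x + g x) has_derivative (\<lambda>h. frechet_derivative f (at x) h + frechet_derivative g (at x) h)) (at x)" for x
      using Suc.prems by (intro has_derivative_add) (auto simp: frechet_derivative_works[symmetric])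
  qed (use Suc in auto)
qed (auto intro: continuous_intros)

lemma Ck_on_mult: "Ck_on k UNIV f \<Longrightarrow> Ck_on k UNIV g \<Longrightarrow> Ck_on k UNIV (\<lambda>x. f x * g x)"
proof (induction k arbitrary: f g)
  case (Suc k)
  show ?case
  proof (rule Ck_on_SucI)
    show "((\<lambda>x. f x * g x) has_derivative (\<lambda>h. f x * frechet_derivative g (at x) h + frechet_derivative f (at x) h * g x)) (at x)" for x
      using Suc.prems by (intro has_derivative_mult) (auto simp: frechet_derivative_works[symmetric])
    show "Ck_on k UNIV (\<lambda>x. f x * frechet_derivative g (at x) b + frechet_derivative f (at x) b * g x)"
      if "b \<in> Basis" for b
      \<comment> \<open>Each Leibniz term pairs a derivative of class \<open>k\<close> with an
        undifferentiated factor of class \<open>Suc k\<close>, which is lowered to class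
        \<open>k\<close> for the induction hypothesis.\<close>
      using Suc.prems Suc.prems[THEN Ck_on_Suc_imp] that
      by (intro Ck_on_add Suc.IH) auto
  qed
qed (auto intro: continuous_intros)

lemma smooth_mult: "smooth f \<Longrightarrow> smooth g \<Longrightarrow> smooth (\<lambda>x. f x * g x)"
  by (simp add: smooth_def Ck_on_mult)

lemma smooth_prod:
  assumes "\<And>i. i \<in> I \<Longrightarrow> smooth (f i)"
  shows "smooth (\<lambda>x. \<Prod>i\<in>I. f i x)"
  using assms
  by (induction I rule: infinite_finite_induct) (simp_all add: smooth_const smooth_mult)

text \<open>The functions \<open>p(1/t) e\<^bsup>-1/t\<^esup>\<close> extended by \<open>0\<close> to \<open>t \<le> 0\<close> are closed under differentiation.\<close>

definition flat_exp :: "real poly \<Rightarrow> real \<Rightarrow> real" where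
  "flat_exp p t = (if t > 0 then poly p (1 / t) * exp (- (1 / t)) else 0)"

lemma flat_exp_smult: "flat_exp (smult c p) t = c * flat_exp p t"
  by (simp add: flat_exp_def)

lemma poly_times_exp_minus_tendsto_0:
  fixes p :: "real poly"
  shows "((\<lambda>s. poly p s * exp (- s)) \<longlongrightarrow> 0) at_top"
proof -
  have "((\<lambda>s. \<Sum>i\<le>degree p. coeff p i * (s ^ i / exp s)) \<longlongrightarrow> (\<Sum>i\<le>degree p. coeff p i * 0)) at_top"
    by (intro tendsto_intros tendsto_power_div_exp_0)
  then show ?thesis
    by (simp add: poly_altdef exp_minus sum_distrib_right divide_inverse mult.assoc)
qed

text \<open>In the variable s = 1/t the chain rule gives s^2 (p(s) - p'(s)) e^(-s), and
  \<open>[:0, 0, 1:]\<close> is s^2. At the junction t = 0 exponential decay beats every polynomial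
  in s.\<close>

lemma flat_exp_has_derivative:
  "(flat_exp p has_real_derivative flat_exp ([:0, 0, 1:] * (p - pderiv p)) t) (at t)"
proof (cases t "0::real" rule: linorder_cases)
  case less
  have "((\<lambda>t. 0) has_real_derivative 0) (at t)" by simp
  then have "(flat_exp p has_real_derivative 0) (at t)"
    by (rule has_field_derivative_transform_within_open[where S="{..<0}"])
      (use less in \<open>auto simp: flat_exp_def\<close>)
  then show ?thesis using less by (simp add: flat_exp_def)
next
  case equal
  have "((\<lambda>h. flat_exp p h / h) \<longlongrightarrow> 0) (at_right 0)"
  proof -
    \<comment> \<open>The difference quotient is s p(s) e^(-s) at s = 1/h, hence the extra factor
      \<open>[:0, 1:]\<close>.\<close>
    have "((\<lambda>h::real. poly ([:0, 1:] * p) (inverse h) * exp (- inverse h)) \<longlongrightarrow> 0) (at_right 0)"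
      using filterlim_compose[OF poly_times_exp_minus_tendsto_0 filterlim_inverse_at_top_right] .
    then show ?thesis
      by (rule Lim_transform_eventually)
        (auto simp: eventually_at_right_field flat_exp_def field_simps intro!: exI[of _ 1])
  qed
  moreover have "((\<lambda>h. flat_exp p h / h) \<longlongrightarrow> 0) (at_left 0)"
    by (rule Lim_transform_eventually[OF tendsto_const])
      (auto simp: eventually_at_left_field flat_exp_def intro!: exI[of _ "-1"])
  ultimately have "((\<lambda>h. flat_exp p h / h) \<longlongrightarrow> 0) (at 0)"
    by (simp add: filterlim_split_at)
  then show ?thesis
    using equal by (simp add: DERIV_def flat_exp_def)
next
  case greater
  have inv: "((\<lambda>t. 1 / t) has_real_derivative - (1 / t\<^sup>2)) (at t)"
    using DERIV_inverse[of t] greater by (simp add: divide_inverse power2_eq_square)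
  have "((\<lambda>t. poly p (1 / t) * exp (- (1 / t))) has_real_derivative
      poly (pderiv p) (1 / t) * - (1 / t\<^sup>2) * exp (- (1 / t)) +
      exp (- (1 / t)) * - (- (1 / t\<^sup>2)) * poly p (1 / t)) (at t)"
    by (intro DERIV_mult DERIV_chain2[OF poly_DERIV inv] DERIV_chain2[OF DERIV_exp DERIV_minus[OF inv]])
  then have "((\<lambda>t. poly p (1 / t) * exp (- (1 / t))) has_real_derivative
      flat_exp ([:0, 0, 1:] * (p - pderiv p)) t) (at t)"
    using greater by (simp add: flat_exp_def algebra_simps power2_eq_square)
  then show ?thesis
    by (rule has_field_derivative_transform_within_open[where S="{0<..}"])
      (use greater in \<open>auto simp: flat_exp_def\<close>)
qed

text \<open>The directional factor \<open>h \<bullet> v\<close> is absorbed into the polynomial by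
  \<open>smult\<close>, so every partial derivative stays in the family and the induction over
  \<open>k\<close> with \<open>p\<close> arbitrary closes.\<close>

lemma smooth_flat_exp: "smooth (\<lambda>x. flat_exp p (x \<bullet> v + a))"
proof -
  have "Ck_on k UNIV (\<lambda>x::'a. flat_exp p (x \<bullet> v + a))" for k
  proof (induction k arbitrary: p)
    case 0
    have "continuous_on UNIV (flat_exp p)"
      using flat_exp_has_derivative DERIV_isCont continuous_at_imp_continuous_on by blast
    then have "continuous_on UNIV (\<lambda>x::'a. flat_exp p (x \<bullet> v + a))"
      by (rule continuous_on_compose2) (auto intro!: continuous_intros)
    then show ?case by simp
  next
    case (Suc k)
    show ?case
    proof (rule Ck_on_SucI)
      let ?q = "[:0, 0, 1:] * (p - pderiv p)"
      show "((\<lambda>x::'a. flat_exp p (x \<bullet> v + a)) has_derivative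
              (\<lambda>h. flat_exp (smult (h \<bullet> v) ?q) (x \<bullet> v + a))) (at x)" for x
      proof -
        have 1: "((\<lambda>x::'a. x \<bullet> v + a) has_derivative (\<lambda>h. h \<bullet> v)) (at x)"
          by (auto intro!: derivative_eq_intros)
        show ?thesis
          using DERIV_compose_FDERIV[OF flat_exp_has_derivative 1]
          by (rule has_derivative_eq_rhs) (simp only: flat_exp_smult mult.commute)
      qed
    qed (rule Suc)
  qed
  then show ?thesis by (simp add: smooth_def)
qed

section \<open>Test functions\<close>

lemma test_functionsD:
  assumes "\<psi> \<in> test_functions B"
  shows "smooth \<psi>" "compact (closure {x. \<psi> x \<noteq> 0})" "closure {x. \<psi> x \<noteq> 0} \<subseteq> B"
  using assms by (auto simp: test_functions_def smooth_def)

lemma test_functionsI: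
  assumes "smooth \<psi>" "compact K" "K \<subseteq> B" "\<And>x. x \<notin> K \<Longrightarrow> \<psi> x = 0"
  shows "\<psi> \<in> test_functions B"
proof -
  have "closure {x. \<psi> x \<noteq> 0} \<subseteq> K"
    using assms by (intro closure_minimal) (auto simp: compact_imp_closed)
  then show ?thesis
    using assms(1-3) compact_Int_closed[OF assms(2) closed_closure, of "{x. \<psi> x \<noteq> 0}"]
    by (simp add: test_functions_def smooth_def Int_absorb1)
qed

text \<open>The complement of the support is open, so the gradient vanishes there along with the
  function; compactness of \<open>K\<close> later turns continuity into boundedness and
  integrability.\<close>

lemma test_functionE:
  assumes "\<psi> \<in> test_functions B"
  obtains K where "compact K" "K \<subseteq> B" "\<And>x. x \<notin> K \<Longrightarrow> \<psi> x = 0" "\<And>x. x \<notin> K \<Longrightarrow> gradient \<psi> x = 0"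
proof -
  define K where "K = closure {x. \<psi> x \<noteq> 0}"
  have 0: "\<psi> x = 0" if "x \<notin> K" for x
    using that closure_subset[of "{x. \<psi> x \<noteq> 0}"] unfolding K_def by auto
  have "gradient \<psi> x = 0" if "x \<notin> K" for x
  proof (rule gradient_eqI)
    show "(\<psi> has_derivative (\<bullet>) 0) (at x)"
    proof (rule has_derivative_transform_within_open[where s="-K" and f="\<lambda>x. 0"])
      show "open (- K)" by (simp add: K_def open_Compl)
      have "(\<bullet>) (0::'a) = (\<lambda>h. 0)" by auto
      then show "((\<lambda>x. 0) has_derivative (\<bullet>) (0::'a)) (at x)" by simp
    qed (use that 0 in auto)
  qed
  then show thesis
    using that[of K] 0 test_functionsD[OF assms] unfolding K_def by blast
qed

lemma test_function_mult:
  assumes "\<psi> \<in> test_functions B" "smooth f"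
  shows "(\<lambda>x. \<psi> x * f x) \<in> test_functions B"
proof -
  obtain K where "compact K" "K \<subseteq> B" "\<And>x. x \<notin> K \<Longrightarrow> \<psi> x = 0"
    using test_functionE[OF assms(1)] by metis
  then show ?thesis
    using assms test_functionsD(1) by (intro test_functionsI[of _ K] smooth_mult) auto
qed

lemma test_function_bounded:
  assumes "\<psi> \<in> test_functions B"
  obtains M where "M > 0" "\<And>x. \<bar>\<psi> x\<bar> \<le> M" "\<And>x. norm (gradient \<psi> x) \<le> M"
proof -
  obtain K where K: "compact K" "K \<subseteq> B" "\<And>x. x \<notin> K \<Longrightarrow> \<psi> x = 0" "\<And>x. x \<notin> K \<Longrightarrow> gradient \<psi> x = 0"
    using test_functionE[OF assms] by metis
  have "bounded (\<psi> ` K)" "bounded (gradient \<psi> ` K)"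
    using K(1) smoothD(2,3)[OF test_functionsD(1)[OF assms]]
    by (auto intro!: compact_imp_bounded compact_continuous_image)
  then obtain M1 M2 where M: "\<And>x. x \<in> K \<Longrightarrow> \<bar>\<psi> x\<bar> \<le> M1" "\<And>x. x \<in> K \<Longrightarrow> norm (gradient \<psi> x) \<le> M2"
    unfolding bounded_iff by auto
  have "\<bar>\<psi> x\<bar> \<le> 1 + \<bar>M1\<bar> + \<bar>M2\<bar>" "norm (gradient \<psi> x) \<le> 1 + \<bar>M1\<bar> + \<bar>M2\<bar>" for x
    using M(1)[of x] M(2)[of x] K(3,4)[of x] by (cases "x \<in> K"; simp; linarith)+
  then show thesis by (intro that[of "1 + \<bar>M1\<bar> + \<bar>M2\<bar>"]) auto
qed

lemma test_function_Lipschitz: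
  assumes "\<psi> \<in> test_functions B"
  obtains M where "M > 0" "\<And>x y. \<bar>\<psi> x - \<psi> y\<bar> \<le> M * norm (x - y)"
proof -
  obtain M where M: "M > 0" "\<And>x. norm (gradient \<psi> x) \<le> M"
    using test_function_bounded[OF assms] by metis
  have "norm (\<psi> x - \<psi> y) \<le> M * norm (x - y)" for x y
  proof (rule differentiable_bound[of UNIV _ "\<lambda>x h. gradient \<psi> x \<bullet> h"])
    show "(\<psi> has_derivative (\<bullet>) (gradient \<psi> x)) (at x within UNIV)" for x
      using has_derivative_gradient smoothD(1) test_functionsD(1)[OF assms] by auto
    show "onorm ((\<bullet>) (gradient \<psi> x)) \<le> M" for x
    proof (rule onorm_le)
      show "norm (gradient \<psi> x \<bullet> h) \<le> M * norm h" for h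
        using Cauchy_Schwarz_ineq2[of "gradient \<psi> x" h] mult_right_mono[OF M(2)[of x], of "norm h"]
        by simp
    qed
  qed auto
  then show thesis using M(1) by (intro that[of M]) auto
qed

section \<open>Smooth bumps approximating indicators of boxes\<close>

text \<open>\<open>flat_exp 1\<close> is exp(-1/t) for t > 0. Stretching its argument by
  \<open>Suc m\<close> keeps the support in the same closed box while every factor tends to 1
  inside, so the bumps converge boundedly to the indicator of the open box.\<close>

definition box_bump :: "'a::euclidean_space \<Rightarrow> 'a \<Rightarrow> nat \<Rightarrow> 'a \<Rightarrow> real" where
  "box_bump a b m x =
     (\<Prod>i\<in>Basis. flat_exp 1 (real (Suc m) * (x \<bullet> i - a \<bullet> i)) * flat_exp 1 (real (Suc m) * (b \<bullet> i - x \<bullet> i)))"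

lemma flat_exp_1_bounds: "0 \<le> flat_exp 1 t" "flat_exp 1 t \<le> 1"
  by (auto simp: flat_exp_def)

lemma box_bump_bounds: "0 \<le> box_bump a b m x" "box_bump a b m x \<le> 1"
  unfolding box_bump_def
  by (auto intro!: prod_nonneg prod_le_1 mult_nonneg_nonneg mult_le_one simp: flat_exp_1_bounds)

lemma box_bump_eq_0: "x \<notin> box a b \<Longrightarrow> box_bump a b m x = 0"
proof -
  assume "x \<notin> box a b"
  then obtain i where i: "i \<in> Basis" "x \<bullet> i - a \<bullet> i \<le> 0 \<or> b \<bullet> i - x \<bullet> i \<le> 0"
    by (force simp: mem_box)
  then have "flat_exp 1 (real (Suc m) * (x \<bullet> i - a \<bullet> i)) * flat_exp 1 (real (Suc m) * (b \<bullet> i - x \<bullet> i)) = 0"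
    by (auto simp: flat_exp_def zero_less_mult_iff)
  with i(1) show ?thesis unfolding box_bump_def by (intro prod_zero) auto
qed

lemma box_bump_test_function:
  assumes "cbox a b \<subseteq> B"
  shows "box_bump a b m \<in> test_functions B"
proof (rule test_functionsI[of _ "cbox a b"])
  have "smooth (\<lambda>x. flat_exp 1 (real (Suc m) * (x \<bullet> i - a \<bullet> i)))" for i
    using smooth_flat_exp[of 1 "real (Suc m) *\<^sub>R i" "- (real (Suc m) * (a \<bullet> i))"]
    by (simp add: algebra_simps)
  moreover have "smooth (\<lambda>x. flat_exp 1 (real (Suc m) * (b \<bullet> i - x \<bullet> i)))" for i
    using smooth_flat_exp[of 1 "- real (Suc m) *\<^sub>R i" "real (Suc m) * (b \<bullet> i)"]
    by (simp add: algebra_simps)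
  ultimately show "smooth (box_bump a b m)"
    unfolding box_bump_def by (intro smooth_prod smooth_mult)
  show "box_bump a b m x = 0" if "x \<notin> cbox a b" for x
    using that box_subset_cbox by (intro box_bump_eq_0) blast
qed (use assms in auto)

lemma box_bump_tendsto_indicator: "(\<lambda>m. box_bump a b m x) \<longlonglongrightarrow> indicator (box a b) x"
proof (cases "x \<in> box a b")
  case True
  have *: "(\<lambda>m. flat_exp 1 (real (Suc m) * t)) \<longlonglongrightarrow> 1" if "t > 0" for t
  proof -
    have "(\<lambda>m. exp (- (inverse (real (Suc m)) * inverse t))) \<longlonglongrightarrow> exp (- (0 * inverse t))"
      by (intro tendsto_intros LIMSEQ_inverse_real_of_nat)
    then show ?thesis
      using that by (simp add: flat_exp_def inverse_eq_divide mult.commute del: of_nat_Suc)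
  qed
  have "(\<lambda>m. box_bump a b m x) \<longlonglongrightarrow> (\<Prod>i\<in>(Basis::'a set). 1 * 1)"
    unfolding box_bump_def using True by (intro tendsto_intros *) (auto simp: mem_box)
  then show ?thesis using True by simp
qed (simp add: box_bump_eq_0)

section \<open>The fundamental lemma of the calculus of variations\<close>

lemma integral_lebesgue_on_supported:
  fixes f :: "'a::euclidean_space \<Rightarrow> 'b::euclidean_space"
  assumes "S \<in> sets lebesgue" "\<And>x. x \<notin> S \<Longrightarrow> f x = 0"
  shows "(LINT x|lebesgue_on S. f x) = (LINT x|lebesgue. f x)"
proof -
  have "indicator S x *\<^sub>R f x = f x" for x using assms(2) by (cases "x \<in> S") auto
  then show ?thesis using assms(1) by (simp add: integral_restrict_space)
qed

lemma integrable_lebesgue_on_supported: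
  fixes f :: "'a::euclidean_space \<Rightarrow> 'b::euclidean_space"
  assumes "S \<in> sets lebesgue" "\<And>x. x \<notin> S \<Longrightarrow> f x = 0"
  shows "integrable (lebesgue_on S) f \<longleftrightarrow> integrable lebesgue f"
proof -
  have "indicator S x *\<^sub>R f x = f x" for x using assms(2) by (cases "x \<in> S") auto
  then show ?thesis using assms(1) by (simp add: integrable_restrict_space)
qed

text \<open>The sets over which \<open>f\<close> integrates to zero are closed under complements and
  countable disjoint unions, and open boxes are an intersection-stable generator of the Borel sets;
  Lebesgue sets differ from Borel sets by null sets.\<close>

lemma AE_zero_if_box_integrals_zero:
  fixes f :: "'a::euclidean_space \<Rightarrow> 'b::euclidean_space"
  assumes f: "integrable lebesgue f"
    and box: "\<And>a b. (LINT x:box a b|lebesgue. f x) = 0"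
  shows "AE x in lebesgue. f x = 0"
proof (rule sigma_finite_measure.density_zero[OF _ f])
  show "sigma_finite_measure (lebesgue :: 'a measure)"
  proof
    obtain A :: "'a set set" where "countable A \<and> A \<subseteq> sets lborel \<and> \<Union>A = space lborel \<and>
        (\<forall>a\<in>A. emeasure lborel a \<noteq> \<infinity>)"
      using lborel.sigma_finite_countable by (rule exE)
    then have A: "countable A" "A \<subseteq> sets lborel" "\<Union>A = space lborel"
        "\<And>a. a \<in> A \<Longrightarrow> emeasure lborel a \<noteq> \<infinity>"
      by auto
    have "emeasure lebesgue a \<noteq> \<infinity>" if "a \<in> A" for a
      using A(2) A(4)[OF that] that by (simp add: subset_eq)
    moreover have "A \<subseteq> sets lebesgue" "\<Union>A = space lebesgue"
      using A(2,3) sets_completionI_sets[of _ lborel] by (simp_all add: subset_iff del: sets_lborel)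
    ultimately show "\<exists>A::'a set set. countable A \<and> A \<subseteq> sets lebesgue \<and> \<Union>A = space lebesgue \<and>
        (\<forall>a\<in>A. emeasure lebesgue a \<noteq> \<infinity>)"
      using A(1) by (intro exI[of _ A] conjI ballI)
  qed
  have si: "set_integrable lebesgue A f" if "A \<in> sets lebesgue" for A
    using f that unfolding set_integrable_def by (rule integrable_mult_indicator[rotated])
  \<comment> \<open>Needed for complements: the whole space is exhausted by growing boxes.\<close>
  have tot: "(LINT x|lebesgue. f x) = 0"
  proof -
    let ?B = "\<lambda>n::nat. box (- (real n *\<^sub>R One)) (real n *\<^sub>R One) :: 'a set"
    have "(\<lambda>n. LINT x|lebesgue. indicator (?B n) x *\<^sub>R f x) \<longlonglongrightarrow> (LINT x|lebesgue. f x)"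
    proof (rule integral_dominated_convergence[where w="\<lambda>x. norm (f x)"])
      have "(\<lambda>n. indicator (?B n) x *\<^sub>R f x) \<longlonglongrightarrow> f x" for x
      proof -
        obtain N where N: "norm x < real N" using reals_Archimedean2 by blast
        have "x \<in> ?B n" if "n \<ge> N" for n
        proof -
          have "- real n < x \<bullet> i" "x \<bullet> i < real n" if "i \<in> Basis" for i
            using Basis_le_norm[OF that, of x] N \<open>n \<ge> N\<close> by linarith+
          then show ?thesis by (simp add: mem_box)
        qed
        then have "\<forall>\<^sub>F n in sequentially. indicator (?B n) x *\<^sub>R f x = f x"
          by (auto simp: eventually_sequentially intro!: exI[of _ N])
        then show ?thesis by (rule tendsto_eventually)
      qed
      then show "AE x in lebesgue. (\<lambda>n. indicator (?B n) x *\<^sub>R f x) \<longlonglongrightarrow> f x" by simp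
      show "(\<lambda>x. indicator (?B n) x *\<^sub>R f x) \<in> borel_measurable lebesgue" for n
        using si[of "?B n"] by (simp add: set_integrable_def sets_completionI_sets borel_measurable_integrable)
    qed (use f in \<open>auto simp: indicator_def\<close>)
    moreover have "(LINT x|lebesgue. indicator (?B n) x *\<^sub>R f x) = 0" for n
      using box by (simp add: set_lebesgue_integral_def)
    ultimately show ?thesis by (simp add: LIMSEQ_const_iff)
  qed
  have borel: "(LINT x:A|lebesgue. f x) = 0" if "A \<in> sets borel" for A
  proof -
    have "Int_stable (range (\<lambda>(a, b). box a b :: 'a set))"
      by (auto simp: Int_stable_def box_Int_box)
    moreover have "range (\<lambda>(a, b). box a b :: 'a set) \<subseteq> Pow UNIV" by simp
    moreover have "A \<in> sigma_sets UNIV (range (\<lambda>(a, b). box a b :: 'a set))"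
      using that unfolding borel_eq_box by simp
    ultimately show ?thesis
    proof (induction rule: sigma_sets_induct_disjoint)
      case (basic A)
      then show ?case using box by auto
    next
      case (compl A)
      then have "A \<in> sets lborel" unfolding sets_lborel borel_eq_box by simp
      then have A: "A \<in> sets lebesgue" by (rule sets_completionI_sets)
      have "(LINT x:UNIV - A|lebesgue. f x) = (LINT x|lebesgue. f x - indicator A x *\<^sub>R f x)"
        unfolding set_lebesgue_integral_def by (intro Bochner_Integration.integral_cong) (auto simp: indicator_def)
      also have "\<dots> = (LINT x|lebesgue. f x) - (LINT x:A|lebesgue. f x)"
        using f si[OF A] unfolding set_lebesgue_integral_def set_integrable_def
        by (rule Bochner_Integration.integral_diff)
      finally show ?case using tot compl by simp
    next
      case (union F)
      then have "F i \<in> sets lborel" for i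
        unfolding sets_lborel borel_eq_box by (simp add: image_subset_iff)
      then have F: "F i \<in> sets lebesgue" for i
        by (rule sets_completionI_sets)
      have "(LINT x:(\<Union>i. F i)|lebesgue. f x) = (\<Sum>i. LINT x:F i|lebesgue. f x)"
        using union(1) F by (intro lebesgue_integral_countable_add si) (auto simp: disjoint_family_on_def)
      then show ?case using union by simp
    qed (auto simp: set_lebesgue_integral_def)
  qed
  fix A :: "'a set" assume "A \<in> sets lebesgue"
  then obtain S N N' where A: "A = S \<union> N" "N \<subseteq> N'" "N' \<in> null_sets lborel" "S \<in> sets lborel"
    by (rule sets_completionE)
  have S: "S \<in> sets lebesgue" using A by (simp add: sets_completionI_sets)
  have "AE x in lebesgue. x \<notin> N'" using A(3) by (intro AE_not_in null_sets_completionI)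
  then have ae: "AE x in lebesgue. indicator A x *\<^sub>R f x = indicator S x *\<^sub>R f x"
    by eventually_elim (use A(1,2) in \<open>auto simp: indicator_def\<close>)
  have "(LINT x:A|lebesgue. f x) = (LINT x:S|lebesgue. f x)"
    unfolding set_lebesgue_integral_def
    using ae si[OF \<open>A \<in> sets lebesgue\<close>] si[OF S] unfolding set_integrable_def
    by (intro integral_cong_AE) (auto dest: borel_measurable_integrable)
  then show "(LINT x:A|lebesgue. f x) = 0" using borel A(4) by simp
qed

text \<open>Squares of test functions suffice, since the squares of the bumps also tend to the indicator of a box.\<close>

lemma AE_zero_if_test_integrals_zero:
  fixes g :: "'a::euclidean_space \<Rightarrow> 'b::euclidean_space"
  assumes "open B" and loc: "locally_integrable B g"
    and test: "\<And>\<psi>. \<psi> \<in> test_functions B \<Longrightarrow> (LINT x|lebesgue_on B. (\<psi> x)\<^sup>2 *\<^sub>R g x) = 0"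
  shows "AE x in lebesgue_on B. g x = 0"
proof -
  have B: "B \<in> sets lebesgue" using \<open>open B\<close> by (simp add: sets_completionI_sets)
  have int_K: "integrable lebesgue (\<lambda>x. indicator K x *\<^sub>R g x)" if "compact K" "K \<subseteq> B" for K
    using loc that unfolding locally_integrable_def
    by (simp add: integrable_restrict_space[symmetric] sets_completionI_sets borel_compact)
  have box0: "(LINT x:box p q|lebesgue. g x) = 0" if "cbox p q \<subseteq> B" for p q
  proof -
    have pt: "box_bump p q m x = 0" if "x \<notin> cbox p q" for m x
      using that box_subset_cbox box_bump_eq_0 by blast
    \<comment> \<open>The factor \<open>indicator (cbox p q)\<close> changes nothing, since the
      bumps vanish off the closed box, and it makes the locally integrable \<open>g\<close> globally
      integrable, so that it serves as its own majorant.\<close>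
    have "(\<lambda>m. LINT x|lebesgue. (box_bump p q m x)\<^sup>2 *\<^sub>R (indicator (cbox p q) x *\<^sub>R g x))
        \<longlonglongrightarrow> (LINT x|lebesgue. indicator (box p q) x *\<^sub>R g x)"
    proof (rule integral_dominated_convergence[where w="\<lambda>x. norm (indicator (cbox p q) x *\<^sub>R g x)"])
      have meas: "(\<lambda>x. indicator (cbox p q) x *\<^sub>R g x) \<in> borel_measurable lebesgue"
        using int_K[OF compact_cbox that] by (rule borel_measurable_integrable)
      have "(\<lambda>x. indicator (box p q) x *\<^sub>R (indicator (cbox p q) x *\<^sub>R g x)) \<in> borel_measurable lebesgue"
        by (intro borel_measurable_scaleR[OF _ meas] borel_measurable_indicator) (simp add: sets_completionI_sets)
      moreover have "(\<lambda>x. indicator (box p q) x *\<^sub>R (indicator (cbox p q) x *\<^sub>R g x))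
          = (\<lambda>x. indicator (box p q) x *\<^sub>R g x)"
        using box_subset_cbox[of p q] by (auto simp: indicator_def fun_eq_iff)
      ultimately show "(\<lambda>x. indicator (box p q) x *\<^sub>R g x) \<in> borel_measurable lebesgue" by simp
      show "(\<lambda>x. (box_bump p q m x)\<^sup>2 *\<^sub>R (indicator (cbox p q) x *\<^sub>R g x)) \<in> borel_measurable lebesgue" for m
      proof (intro borel_measurable_scaleR[OF _ meas] borel_measurable_power)
        have "box_bump p q m \<in> borel_measurable borel"
          using smoothD(2)[OF test_functionsD(1)[OF box_bump_test_function[OF that]]]
          by (rule borel_measurable_continuous_onI)
        then show "box_bump p q m \<in> borel_measurable lebesgue"
          by (simp add: measurable_completion)
      qed
      show "integrable lebesgue (\<lambda>x. norm (indicator (cbox p q) x *\<^sub>R g x))"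
        using int_K[OF compact_cbox that] by (rule integrable_norm)
      have "(\<lambda>m. (box_bump p q m x)\<^sup>2 *\<^sub>R (indicator (cbox p q) x *\<^sub>R g x)) \<longlonglongrightarrow>
          (indicator (box p q) x)\<^sup>2 *\<^sub>R (indicator (cbox p q) x *\<^sub>R g x)" for x
        by (intro tendsto_intros box_bump_tendsto_indicator)
      moreover have "(indicator (box p q) x)\<^sup>2 *\<^sub>R (indicator (cbox p q) x *\<^sub>R g x) = indicator (box p q) x *\<^sub>R g x" for x
        using box_subset_cbox[of p q] by (auto simp: indicator_def)
      ultimately have "(\<lambda>m. (box_bump p q m x)\<^sup>2 *\<^sub>R (indicator (cbox p q) x *\<^sub>R g x)) \<longlonglongrightarrow>
          indicator (box p q) x *\<^sub>R g x" for x
        by (simp only:)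
      then show "AE x in lebesgue. (\<lambda>m. (box_bump p q m x)\<^sup>2 *\<^sub>R (indicator (cbox p q) x *\<^sub>R g x)) \<longlonglongrightarrow>
          indicator (box p q) x *\<^sub>R g x"
        by (rule AE_I2)
      show "AE x in lebesgue. norm ((box_bump p q m x)\<^sup>2 *\<^sub>R (indicator (cbox p q) x *\<^sub>R g x))
          \<le> norm (indicator (cbox p q) x *\<^sub>R g x)" for m
      proof (rule AE_I2)
        fix x
        have "\<bar>(box_bump p q m x)\<^sup>2\<bar> \<le> 1" using box_bump_bounds[of p q m x] by (simp add: power_le_one)
        then show "norm ((box_bump p q m x)\<^sup>2 *\<^sub>R (indicator (cbox p q) x *\<^sub>R g x)) \<le> norm (indicator (cbox p q) x *\<^sub>R g x)"
          unfolding norm_scaleR by (intro mult_left_le_one_le mult_nonneg_nonneg) auto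
      qed
    qed
    moreover have "(LINT x|lebesgue. (box_bump p q m x)\<^sup>2 *\<^sub>R (indicator (cbox p q) x *\<^sub>R g x)) = 0" for m
    proof -
      have "(LINT x|lebesgue. (box_bump p q m x)\<^sup>2 *\<^sub>R (indicator (cbox p q) x *\<^sub>R g x))
          = (LINT x|lebesgue. (box_bump p q m x)\<^sup>2 *\<^sub>R g x)"
        using pt by (intro Bochner_Integration.integral_cong) (auto simp: indicator_def)
      also have "\<dots> = (LINT x|lebesgue_on B. (box_bump p q m x)\<^sup>2 *\<^sub>R g x)"
        using that pt by (intro integral_lebesgue_on_supported[OF B, symmetric]) auto
      finally show ?thesis using test[OF box_bump_test_function[OF that]] by simp
    qed
    ultimately show ?thesis
      by (simp add: LIMSEQ_const_iff set_lebesgue_integral_def)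
  qed
  have box_ae: "AE x in lebesgue. x \<in> cbox c d \<longrightarrow> g x = 0" if cd: "cbox c d \<subseteq> B" for c d
  proof -
    \<comment> \<open>Localizing to \<open>box c d\<close> is compatible with box integrals because
      two open boxes meet in an open box.\<close>
    have "AE x in lebesgue. indicator (box c d) x *\<^sub>R g x = 0"
    proof (rule AE_zero_if_box_integrals_zero)
      have "integrable lebesgue (\<lambda>x. indicator (box c d) x *\<^sub>R (indicator (cbox c d) x *\<^sub>R g x))"
        by (intro integrable_mult_indicator int_K cd) (auto simp: sets_completionI_sets)
      moreover have "(\<lambda>x. indicator (box c d) x *\<^sub>R (indicator (cbox c d) x *\<^sub>R g x))
          = (\<lambda>x. indicator (box c d) x *\<^sub>R g x)"
        using box_subset_cbox[of c d] by (auto simp: indicator_def fun_eq_iff)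
      ultimately show "integrable lebesgue (\<lambda>x. indicator (box c d) x *\<^sub>R g x)" by simp
      fix a b
      obtain p q where pq: "box a b \<inter> box c d = box p q" using box_Int_box by blast
      have "(LINT x:box a b|lebesgue. indicator (box c d) x *\<^sub>R g x) = (LINT x:box p q|lebesgue. g x)"
        unfolding set_lebesgue_integral_def pq[symmetric]
        by (intro Bochner_Integration.integral_cong) (auto simp: indicator_def)
      also have "\<dots> = 0"
      \<comment> \<open>An empty \<open>box p q\<close> does not confine \<open>cbox p q\<close> to
        \<open>B\<close>; only a nonempty one can be handled by passing to closures.\<close>
      proof (cases "box p q = {}")
        case False
        then have "cbox p q \<subseteq> cbox c d"
          using pq by (metis box_subset_cbox closure_box closure_minimal closed_cbox inf_le2 order_trans)
        with cd show ?thesis by (intro box0) auto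
      qed (simp add: set_lebesgue_integral_def)
      finally show "(LINT x:box a b|lebesgue. indicator (box c d) x *\<^sub>R g x) = 0" .
    qed
    moreover have "AE x in lebesgue. x \<notin> cbox c d - box c d"
      using null_sets_cbox_Diff_box by (intro AE_not_in null_sets_completionI)
    ultimately show ?thesis
      by eventually_elim (auto simp: indicator_def split: if_splits)
  qed
  obtain \<D> where D: "countable \<D>" "\<D> \<subseteq> Pow B" "\<And>X. X \<in> \<D> \<Longrightarrow> \<exists>a b. X = cbox a b" "\<Union>\<D> = B"
    using open_countable_Union_open_cbox[OF \<open>open B\<close>] by metis
  have "AE x in lebesgue. \<forall>X\<in>\<D>. x \<in> X \<longrightarrow> g x = 0"
    using D(2,3) box_ae by (subst AE_ball_countable[OF D(1)]) blast
  then have "AE x in lebesgue. x \<in> B \<longrightarrow> g x = 0"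
    by eventually_elim (use D(4) in blast)
  then show ?thesis
    using B by (simp add: AE_restrict_space_iff)
qed

lemma locally_integrable_diff:
  assumes "locally_integrable B f" "locally_integrable B g"
  shows "locally_integrable B (\<lambda>x. f x - g x)"
  using assms by (auto simp: locally_integrable_def)

lemma integrable_test_scaleR:
  fixes g :: "'a::euclidean_space \<Rightarrow> 'b::euclidean_space"
  assumes "open B" "\<psi> \<in> test_functions B" "locally_integrable B g"
  shows "integrable (lebesgue_on B) (\<lambda>x. \<psi> x *\<^sub>R g x)"
proof -
  obtain K where K: "compact K" "K \<subseteq> B" "\<And>x. x \<notin> K \<Longrightarrow> \<psi> x = 0"
    using test_functionE[OF assms(2)] by metis
  obtain M where M: "M > 0" "\<And>x. \<bar>\<psi> x\<bar> \<le> M" using test_function_bounded[OF assms(2)] by metis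
  have gK: "integrable (lebesgue_on K) g" using K assms(3) by (auto simp: locally_integrable_def)
  have "integrable (lebesgue_on K) (\<lambda>x. \<psi> x *\<^sub>R g x)"
  proof (rule Bochner_Integration.integrable_bound)
    show "integrable (lebesgue_on K) (\<lambda>x. M *\<^sub>R g x)" using gK by simp
    have "\<psi> \<in> borel_measurable (lebesgue_on K)"
      using smoothD(2)[OF test_functionsD(1)[OF assms(2)]] K(1)
      by (intro continuous_imp_measurable_on_sets_lebesgue) (auto simp: sets_completionI_sets borel_compact)
    then show "(\<lambda>x. \<psi> x *\<^sub>R g x) \<in> borel_measurable (lebesgue_on K)"
      using gK by (intro borel_measurable_scaleR) auto
    show "AE x in lebesgue_on K. norm (\<psi> x *\<^sub>R g x) \<le> norm (M *\<^sub>R g x)"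
      using M by (auto intro!: mult_right_mono order_trans[OF M(2)])
  qed
  then have "integrable lebesgue (\<lambda>x. \<psi> x *\<^sub>R g x)"
    using K by (subst (asm) integrable_lebesgue_on_supported)
      (auto simp: sets_completionI_sets borel_compact)
  then show ?thesis
    using K assms(1) by (subst integrable_lebesgue_on_supported)
      (auto simp: sets_completionI_sets subset_eq)
qed

lemma has_weak_gradient_unique:
  fixes B :: "'a::euclidean_space set"
  assumes "open B" "has_weak_gradient B f g" "has_weak_gradient B f h"
  shows "AE x in lebesgue_on B. g x = h x"
proof -
  have loc: "locally_integrable B g" "locally_integrable B h"
    using assms by (auto simp: has_weak_gradient_def)
  have "AE x in lebesgue_on B. g x - h x = 0"
  proof (rule AE_zero_if_test_integrals_zero[OF \<open>open B\<close> locally_integrable_diff[OF loc]])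
    fix \<psi> assume "\<psi> \<in> test_functions B"
    \<comment> \<open>Squared so as to match the fundamental lemma, which tests with squares
      only.\<close>
    then have *: "(\<lambda>x. (\<psi> x)\<^sup>2) \<in> test_functions B"
      unfolding power2_eq_square by (intro test_function_mult test_functionsD(1))
    then have "- (LINT x|lebesgue_on B. (\<psi> x)\<^sup>2 *\<^sub>R g x) = - (LINT x|lebesgue_on B. (\<psi> x)\<^sup>2 *\<^sub>R h x)"
      using assms(2,3) unfolding has_weak_gradient_def by metis
    then show "(LINT x|lebesgue_on B. (\<psi> x)\<^sup>2 *\<^sub>R (g x - h x)) = 0"
      unfolding scaleR_diff_right
      by (subst Bochner_Integration.integral_diff) (use integrable_test_scaleR[OF \<open>open B\<close> *] loc in auto)
  qed
  then show ?thesis by simp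
qed

text \<open>The only access to \<open>weak_grad\<close>: once any weak gradient is known, the chosen
  one agrees with it off a null set and may be replaced by it under integrals.\<close>

lemma weak_grad_AE_eq:
  fixes B :: "'a::euclidean_space set"
  assumes "open B" "has_weak_gradient B f g"
  shows "AE x in lebesgue_on B. weak_grad B f x = g x"
proof (rule has_weak_gradient_unique[OF \<open>open B\<close>])
  show "has_weak_gradient B f (weak_grad B f)"
    unfolding weak_grad_def by (rule someI[of _ g]) (rule assms(2))
qed (rule assms(2))

section \<open>Weak gradients of Lipschitz functions\<close>

lemma measurable_lebesgue_continuous:
  fixes h :: "'a::euclidean_space \<Rightarrow> 'b::euclidean_space"
  assumes "continuous_on UNIV h"
  shows "h \<in> borel_measurable lebesgue"
proof -
  have "h \<in> borel_measurable lborel" using assms by (simp add: borel_measurable_continuous_onI)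
  then show ?thesis by (rule measurable_completion)
qed

lemma integrable_continuous_supported:
  fixes h :: "'a::euclidean_space \<Rightarrow> 'b::euclidean_space"
  assumes "continuous_on UNIV h" "compact K" "\<And>x. x \<notin> K \<Longrightarrow> h x = 0"
  shows "integrable lebesgue h"
proof -
  have "integrable lborel (\<lambda>x. indicator K x *\<^sub>R h x)"
    using assms(1,2) by (intro borel_integrable_compact) (auto intro: continuous_on_subset)
  moreover have "(\<lambda>x. indicator K x *\<^sub>R h x) = h"
    using assms(3) by (auto simp: indicator_def)
  ultimately show ?thesis
    by (simp add: integrable_completion)
qed

lemma integrable_lebesgue_on_bounded:
  fixes h :: "'a::euclidean_space \<Rightarrow> 'b::euclidean_space"
  assumes "h \<in> borel_measurable lebesgue" "compact K" "AE x in lebesgue. x \<in> K \<longrightarrow> norm (h x) \<le> M"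
  shows "integrable (lebesgue_on K) h"
proof -
  have K: "K \<in> lmeasurable" using assms(2) by (rule lmeasurable_compact)
  interpret finite_measure "lebesgue_on K" using K by (rule finite_measure_lebesgue_on)
  show ?thesis
  proof (rule integrable_const_bound)
    show "AE x in lebesgue_on K. norm (h x) \<le> M"
      using assms(3) fmeasurableD[OF K] by (simp add: AE_restrict_space_iff)
  qed (use assms(1) in \<open>simp add: measurable_restrict_space1\<close>)
qed

lemma integral_lebesgue_translation:
  fixes h :: "'a::euclidean_space \<Rightarrow> 'b::euclidean_space"
  assumes "h \<in> borel_measurable borel"
  shows "(LINT x|lebesgue. h (x + c)) = (LINT x|lebesgue. h x)"
proof -
  have "(LINT x|lebesgue. h x) = (LINT x|distr lborel borel ((+) c). h x)"
    using assms by (simp add: integral_completion lborel_distr_plus)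
  also have "\<dots> = (LINT x|lborel. h (x + c))"
    using assms by (subst integral_distr) (simp_all add: add.commute)
  also have "\<dots> = (LINT x|lebesgue. h (x + c))"
    using assms by (intro integral_completion[symmetric]) simp
  finally show ?thesis ..
qed

lemma inverse_Suc_tendsto_0: "(\<lambda>k. inverse (real (Suc k)) *\<^sub>R b) \<longlonglongrightarrow> (0::'a::real_normed_vector)"
  using tendsto_scaleR[OF LIMSEQ_inverse_real_of_nat tendsto_const[of b]] by simp

text \<open>Caratheodory's form of the derivative, a factor \<open>w\<close> continuous at
  \<open>a\<close>, avoids dividing by \<open>X k - a\<close>, which may vanish for some
  \<open>k\<close>.\<close>

lemma sequential_chain_rule:
  fixes \<Phi> :: "real \<Rightarrow> real"
  assumes "(\<Phi> has_real_derivative D) (at a)" "X \<longlonglongrightarrow> a"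
    and "(\<lambda>k. c k * (X k - a)) \<longlonglongrightarrow> A"
  shows "(\<lambda>k. c k * (\<Phi> (X k) - \<Phi> a)) \<longlonglongrightarrow> D * A"
proof -
  obtain w where w: "\<And>z. \<Phi> z - \<Phi> a = w z * (z - a)" "isCont w a" "w a = D"
    using assms(1) unfolding CARAT_DERIV by blast
  have "(\<lambda>k. w (X k) * (c k * (X k - a))) \<longlonglongrightarrow> D * A"
    using isCont_tendsto_compose[OF w(2) assms(2)] w(3) assms(3) by (auto intro: tendsto_mult)
  then show ?thesis by (simp add: w(1) mult_ac)
qed

lemma difference_quotient_tendsto:
  fixes f :: "'a::euclidean_space \<Rightarrow> real"
  assumes "f differentiable (at x)"
  shows "(\<lambda>k. real (Suc k) * (f (x + inverse (real (Suc k)) *\<^sub>R b) - f x)) \<longlonglongrightarrow> gradient f x \<bullet> b"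
proof -
  have "((\<lambda>t. f (x + t *\<^sub>R b)) has_derivative (\<lambda>t. gradient f x \<bullet> (t *\<^sub>R b))) (at 0)"
    by (rule has_derivative_compose[where f="\<lambda>t. x + t *\<^sub>R b" and g=f, simplified])
      (use has_derivative_gradient[OF assms] in \<open>auto intro!: derivative_eq_intros\<close>)
  then have "((\<lambda>t. f (x + t *\<^sub>R b)) has_real_derivative (gradient f x \<bullet> b)) (at 0)"
    by (simp add: has_field_derivative_def mult_commute_abs)
  from sequential_chain_rule[OF this LIMSEQ_inverse_real_of_nat, of "\<lambda>k. real (Suc k)" 1]
  show ?thesis by simp
qed

lemma Lipschitz_imp_continuous_on:
  fixes f :: "'a::euclidean_space \<Rightarrow> real"
  assumes "\<And>x y. \<bar>f x - f y\<bar> \<le> L * norm (x - y)"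
  shows "continuous_on S f"
proof -
  have "(\<lambda>k. f (X k)) \<longlonglongrightarrow> f x" if X: "X \<longlonglongrightarrow> x" for X x
  proof (rule LIM_zero_cancel, rule Lim_null_comparison)
    show "\<forall>\<^sub>F k in sequentially. norm (f (X k) - f x) \<le> L * norm (X k - x)"
      using assms by simp
    show "(\<lambda>k. L * norm (X k - x)) \<longlonglongrightarrow> 0"
      by (intro tendsto_mult_right_zero tendsto_norm_zero LIM_zero X)
  qed
  then show ?thesis
    unfolding continuous_on_sequentially o_def by simp
qed

text \<open>
  Discrete integration by parts: move the difference quotient from \<open>f\<close> to the test function and
  pass to the limit by dominated convergence on both sides.
\<close>

lemma has_weak_gradient_Lipschitz:
  fixes f :: "'a::euclidean_space \<Rightarrow> real" and g :: "'a \<Rightarrow> 'a"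
  assumes "open B" and lip: "\<And>x y. \<bar>f x - f y\<bar> \<le> L * norm (x - y)"
    and g: "g \<in> borel_measurable lebesgue"
    and lim: "\<And>b. b \<in> Basis \<Longrightarrow> AE x in lebesgue.
      (\<lambda>k. real (Suc k) * (f (x + inverse (real (Suc k)) *\<^sub>R b) - f x)) \<longlonglongrightarrow> g x \<bullet> b"
  shows "AE x in lebesgue. norm (g x) \<le> real DIM('a) * L" "has_weak_gradient B f g"
proof -
  have B: "B \<in> sets lebesgue" using \<open>open B\<close> by (simp add: sets_completionI_sets)
  have q_le: "\<bar>real (Suc k) * (f (x + inverse (real (Suc k)) *\<^sub>R b) - f x)\<bar> \<le> L" if "b \<in> Basis" for k x b
  proof -
    have "\<bar>f (x + inverse (real (Suc k)) *\<^sub>R b) - f x\<bar> \<le> L * inverse (real (Suc k))"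
      using lip[of "x + inverse (real (Suc k)) *\<^sub>R b" x] that by simp
    then have "real (Suc k) * \<bar>f (x + inverse (real (Suc k)) *\<^sub>R b) - f x\<bar> \<le> real (Suc k) * (L * inverse (real (Suc k)))"
      by (intro mult_left_mono) auto
    also have "\<dots> = L" by simp
    finally show ?thesis by (simp only: abs_mult abs_of_nat)
  qed
  have "AE x in lebesgue. \<forall>b\<in>Basis. \<bar>g x \<bullet> b\<bar> \<le> L"
  proof (subst AE_ball_countable)
    show "\<forall>b\<in>Basis. AE x in lebesgue. \<bar>g x \<bullet> b\<bar> \<le> L"
    proof
      fix b :: 'a assume b: "b \<in> Basis"
      show "AE x in lebesgue. \<bar>g x \<bullet> b\<bar> \<le> L"
        using lim[OF b]
      proof eventually_elim
        case (elim x)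
        then show ?case
          by (rule LIMSEQ_le_const2[OF tendsto_rabs]) (use q_le[OF b] in auto)
      qed
    qed
  qed (simp add: countable_finite)
  then show bound: "AE x in lebesgue. norm (g x) \<le> real DIM('a) * L"
  proof eventually_elim
    case (elim x)
    \<comment> \<open>Bounding the norm by the sum of the components produces the factor
      \<open>DIM('a)\<close>; any uniform bound on \<open>g\<close> serves.\<close>
    have "norm (g x) \<le> (\<Sum>b\<in>Basis. \<bar>g x \<bullet> b\<bar>)" by (rule norm_le_l1)
    also have "\<dots> \<le> (\<Sum>b\<in>(Basis::'a set). L)" using elim by (intro sum_mono) auto
    finally show ?case by simp
  qed
  have cont: "continuous_on S f" for S using lip by (rule Lipschitz_imp_continuous_on)
  have fm: "f \<in> borel_measurable borel" using cont by (rule borel_measurable_continuous_onI)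
  have loc_f: "locally_integrable B f"
    unfolding locally_integrable_def
  proof (intro allI impI)
    fix K :: "'a set" assume K: "compact K \<and> K \<subseteq> B"
    then have "bounded (f ` K)" using cont by (intro compact_imp_bounded compact_continuous_image) auto
    then obtain M where "\<And>x. x \<in> K \<Longrightarrow> norm (f x) \<le> M" unfolding bounded_iff by auto
    then show "integrable (lebesgue_on K) f"
      using K fm by (intro integrable_lebesgue_on_bounded[of _ _ M]) (auto simp: measurable_completion)
  qed
  have loc_g: "locally_integrable B g"
    unfolding locally_integrable_def
  proof (intro allI impI)
    fix K :: "'a set" assume K: "compact K \<and> K \<subseteq> B"
    have "AE x in lebesgue. x \<in> K \<longrightarrow> norm (g x) \<le> real DIM('a) * L"
      using bound by eventually_elim simp
    then show "integrable (lebesgue_on K) g"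
      using K g by (intro integrable_lebesgue_on_bounded) auto
  qed
  \<comment> \<open>The identity is proved over the whole space, where translation invariance
    applies; the support of \<open>\<psi>\<close> brings it back to \<open>B\<close>
    afterwards.\<close>
  have parts: "(LINT x|lebesgue. f x * (gradient \<psi> x \<bullet> b)) = - (LINT x|lebesgue. \<psi> x * (g x \<bullet> b))"
    if \<psi>: "\<psi> \<in> test_functions B" and b: "b \<in> Basis" for \<psi> b
  proof -
    define s where "s = (\<lambda>k. inverse (real (Suc k)))"
    have s: "real (Suc k) * s k = 1" "0 \<le> s k" "s k \<le> 1" for k
      by (simp_all add: s_def field_simps)
    obtain K where K: "compact K" "\<And>x. x \<notin> K \<Longrightarrow> \<psi> x = 0"
      using test_functionE[OF \<psi>] by metis
    have "bounded K" using K(1) by (rule compact_imp_bounded)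
    then obtain R where R: "\<And>x. x \<in> K \<Longrightarrow> norm x \<le> R"
      unfolding bounded_iff by auto
    obtain M where M: "M > 0" "\<And>x y. \<bar>\<psi> x - \<psi> y\<bar> \<le> M * norm (x - y)"
      using test_function_Lipschitz[OF \<psi>] by metis
    have \<psi>c: "continuous_on S \<psi>" for S using smoothD(2)[OF test_functionsD(1)[OF \<psi>]] .
    have \<psi>m: "\<psi> \<in> borel_measurable borel" using \<psi>c by (rule borel_measurable_continuous_onI)
    \<comment> \<open>Translations by \<open>s k \<le> 1\<close> move the support of
      \<open>\<psi>\<close> by at most 1, so all difference quotients of \<open>\<psi>\<close>
      vanish outside the ball of radius \<open>R + 1\<close>, and \<open>f\<close> need only be
      bounded there.\<close>
    have "compact (f ` cball 0 (R + 1))"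
      by (rule compact_continuous_image[OF cont compact_cball])
    then have "\<exists>F. \<forall>y\<in>f ` cball 0 (R + 1). norm y \<le> F"
      by (simp only: compact_imp_bounded bounded_iff[symmetric])
    then obtain F where "\<forall>y\<in>f ` cball 0 (R + 1). norm y \<le> F" ..
    then have F: "\<bar>f x\<bar> \<le> F" if "norm x \<le> R + 1" for x
      using that by simp
    have I: "(\<lambda>k. LINT x|lebesgue. real (Suc k) * (f (x + s k *\<^sub>R b) - f x) * \<psi> x)
        \<longlonglongrightarrow> (LINT x|lebesgue. (g x \<bullet> b) * \<psi> x)"
    proof (rule integral_dominated_convergence[where w="\<lambda>x. L * \<bar>\<psi> x\<bar>"])
      show "(\<lambda>x. (g x \<bullet> b) * \<psi> x) \<in> borel_measurable lebesgue"
        by (intro borel_measurable_times borel_measurable_inner g measurable_lebesgue_continuous \<psi>c borel_measurable_const)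
      show "(\<lambda>x. real (Suc k) * (f (x + s k *\<^sub>R b) - f x) * \<psi> x) \<in> borel_measurable lebesgue" for k
        by (intro measurable_lebesgue_continuous continuous_intros cont \<psi>c
          continuous_on_compose2[OF cont[of UNIV]] continuous_on_compose2[OF \<psi>c[of UNIV]]) auto
      show "integrable lebesgue (\<lambda>x. L * \<bar>\<psi> x\<bar>)"
        by (intro integrable_mult_right integrable_abs integrable_continuous_supported[OF \<psi>c K])
      show "AE x in lebesgue. (\<lambda>k. real (Suc k) * (f (x + s k *\<^sub>R b) - f x) * \<psi> x) \<longlonglongrightarrow> (g x \<bullet> b) * \<psi> x"
        using lim[OF b] by eventually_elim (auto simp: s_def intro: tendsto_mult_right)
      show "AE x in lebesgue. norm (real (Suc k) * (f (x + s k *\<^sub>R b) - f x) * \<psi> x) \<le> L * \<bar>\<psi> x\<bar>" for k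
      proof (rule AE_I2)
        fix x
        show "norm (real (Suc k) * (f (x + s k *\<^sub>R b) - f x) * \<psi> x) \<le> L * \<bar>\<psi> x\<bar>"
          using mult_right_mono[OF q_le[OF b, of k x], of "\<bar>\<psi> x\<bar>"] unfolding s_def
          by (simp only: real_norm_def abs_mult)
      qed
    qed
    \<comment> \<open>A shift of \<open>f\<close> along \<open>b\<close> becomes a shift of
      \<open>\<psi>\<close> along \<open>- b\<close>; this is the source of the minus sign in the
      integration by parts formula.\<close>
    have J: "(\<lambda>k. LINT x|lebesgue. f x * (real (Suc k) * (\<psi> (x + s k *\<^sub>R (- b)) - \<psi> x)))
        \<longlonglongrightarrow> (LINT x|lebesgue. f x * (gradient \<psi> x \<bullet> (- b)))"
    proof (rule integral_dominated_convergence[where w="\<lambda>x. indicator (cball 0 (R + 1)) x *\<^sub>R (F * M)"])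
      show "(\<lambda>x. f x * (gradient \<psi> x \<bullet> (- b))) \<in> borel_measurable lebesgue"
        by (intro measurable_lebesgue_continuous continuous_intros cont smoothD(3) test_functionsD(1)[OF \<psi>])
      show "(\<lambda>x. f x * (real (Suc k) * (\<psi> (x + s k *\<^sub>R (- b)) - \<psi> x))) \<in> borel_measurable lebesgue" for k
        by (intro measurable_lebesgue_continuous continuous_intros cont \<psi>c
          continuous_on_compose2[OF cont[of UNIV]] continuous_on_compose2[OF \<psi>c[of UNIV]]) auto
      have "integrable lborel (\<lambda>x::'a. indicator (cball 0 (R + 1)) x *\<^sub>R (F * M))"
        by (intro borel_integrable_compact) auto
      then show "integrable lebesgue (\<lambda>x::'a. indicator (cball 0 (R + 1)) x *\<^sub>R (F * M))"
        using integrable_completion borel_measurable_integrable by blast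
      have "(\<lambda>k. f x * (real (Suc k) * (\<psi> (x + s k *\<^sub>R (- b)) - \<psi> x))) \<longlonglongrightarrow> f x * (gradient \<psi> x \<bullet> (- b))" for x
        unfolding s_def by (intro tendsto_mult_left difference_quotient_tendsto smoothD(1) test_functionsD(1)[OF \<psi>])
      then show "AE x in lebesgue. (\<lambda>k. f x * (real (Suc k) * (\<psi> (x + s k *\<^sub>R (- b)) - \<psi> x)))
          \<longlonglongrightarrow> f x * (gradient \<psi> x \<bullet> (- b))"
        by (rule AE_I2)
      show "AE x in lebesgue. norm (f x * (real (Suc k) * (\<psi> (x + s k *\<^sub>R (- b)) - \<psi> x)))
          \<le> indicator (cball 0 (R + 1)) x *\<^sub>R (F * M)" for k
      proof (rule AE_I2)
        fix x
        show "norm (f x * (real (Suc k) * (\<psi> (x + s k *\<^sub>R (- b)) - \<psi> x))) \<le> indicator (cball 0 (R + 1)) x *\<^sub>R (F * M)"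
        proof (cases "norm x \<le> R + 1")
          case True
          have "\<bar>\<psi> (x + s k *\<^sub>R (- b)) - \<psi> x\<bar> \<le> M * s k"
            using M(2)[of "x + s k *\<^sub>R (- b)" x] b s(2)[of k] by simp
          then have "real (Suc k) * \<bar>\<psi> (x + s k *\<^sub>R (- b)) - \<psi> x\<bar> \<le> real (Suc k) * (M * s k)"
            by (intro mult_left_mono) auto
          also have "\<dots> = M" using s(1)[of k] by (simp add: mult.left_commute)
          finally have "\<bar>f x\<bar> * (real (Suc k) * \<bar>\<psi> (x + s k *\<^sub>R (- b)) - \<psi> x\<bar>) \<le> F * M"
            using F[OF True] M(1) by (intro mult_mono) auto
          then show ?thesis using True by (simp add: abs_mult)
        next
          case False
          then have "x \<notin> K" using R by force
          moreover have "x + s k *\<^sub>R (- b) \<notin> K"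
          proof
            assume "x + s k *\<^sub>R (- b) \<in> K"
            then have "norm (x - s k *\<^sub>R b) \<le> R" using R by force
            moreover have "norm (s k *\<^sub>R b) \<le> 1" using b s(2,3)[of k] by simp
            ultimately show False using False norm_triangle_sub[of x "s k *\<^sub>R b"] by linarith
          qed
          ultimately show ?thesis using False K(2) by simp
        qed
      qed
    qed
    have "(LINT x|lebesgue. real (Suc k) * (f (x + s k *\<^sub>R b) - f x) * \<psi> x)
        = (LINT x|lebesgue. f x * (real (Suc k) * (\<psi> (x + s k *\<^sub>R (- b)) - \<psi> x)))" for k
    proof -
      let ?h = "\<lambda>x. f x * \<psi> (x - s k *\<^sub>R b)"
      have i1: "integrable lebesgue ?h"
      proof (rule integrable_continuous_supported)
        show "continuous_on UNIV ?h"
          by (intro continuous_intros cont continuous_on_compose2[OF \<psi>c[of UNIV]]) auto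
        show "compact ((+) (s k *\<^sub>R b) ` K)" using K(1) by (rule compact_translation)
        show "?h x = 0" if "x \<notin> (+) (s k *\<^sub>R b) ` K" for x
        proof -
          have "x - s k *\<^sub>R b \<notin> K"
            using that by (metis add.commute diff_add_cancel image_eqI)
          then show ?thesis by (simp add: K(2))
        qed
      qed
      have i2: "integrable lebesgue (\<lambda>x. f x * \<psi> x)"
        by (rule integrable_continuous_supported[OF _ K(1)]) (auto intro!: continuous_intros cont \<psi>c simp: K(2))
      have i3: "integrable lebesgue (\<lambda>x. f (x + s k *\<^sub>R b) * \<psi> x)"
        by (rule integrable_continuous_supported[OF _ K(1)])
          (auto intro!: continuous_intros continuous_on_compose2[OF cont[of UNIV]] \<psi>c simp: K(2))
      have "(LINT x|lebesgue. f (x + s k *\<^sub>R b) * \<psi> x) = (LINT x|lebesgue. ?h x)"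
        using integral_lebesgue_translation[of ?h "s k *\<^sub>R b"] fm \<psi>m by simp
      then have "(LINT x|lebesgue. f (x + s k *\<^sub>R b) * \<psi> x) - (LINT x|lebesgue. f x * \<psi> x)
          = (LINT x|lebesgue. ?h x) - (LINT x|lebesgue. f x * \<psi> x)" by simp
      then have "(LINT x|lebesgue. f (x + s k *\<^sub>R b) * \<psi> x - f x * \<psi> x)
          = (LINT x|lebesgue. ?h x - f x * \<psi> x)"
        by (simp only: Bochner_Integration.integral_diff[OF i3 i2] Bochner_Integration.integral_diff[OF i1 i2])
      then have "real (Suc k) * (LINT x|lebesgue. f (x + s k *\<^sub>R b) * \<psi> x - f x * \<psi> x)
          = real (Suc k) * (LINT x|lebesgue. ?h x - f x * \<psi> x)" by simp
      then show ?thesis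
        unfolding integral_mult_right_zero[symmetric] by (simp add: algebra_simps)
    qed
    then have "(LINT x|lebesgue. (g x \<bullet> b) * \<psi> x) = (LINT x|lebesgue. f x * (gradient \<psi> x \<bullet> (- b)))"
      using LIMSEQ_unique[OF I] J by simp
    then show ?thesis by (simp add: mult.commute)
  qed
  show "has_weak_gradient B f g"
    unfolding has_weak_gradient_def
  proof (intro conjI ballI loc_f loc_g)
    fix \<psi> assume \<psi>: "\<psi> \<in> test_functions B"
    obtain K where K: "compact K" "K \<subseteq> B" "\<And>x. x \<notin> K \<Longrightarrow> \<psi> x = 0" "\<And>x. x \<notin> K \<Longrightarrow> gradient \<psi> x = 0"
      using test_functionE[OF \<psi>] by metis
    have i1: "integrable lebesgue (\<lambda>x. f x *\<^sub>R gradient \<psi> x)"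
      by (rule integrable_continuous_supported[OF _ K(1)])
        (use K(4) in \<open>auto intro!: continuous_intros cont smoothD(3) test_functionsD(1)[OF \<psi>]\<close>)
    have K0: "f x *\<^sub>R gradient \<psi> x = 0" "\<psi> x *\<^sub>R g x = 0" if "x \<notin> B" for x
    proof -
      have "x \<notin> K" using that K(2) by (rule contra_subsetD[rotated])
      then show "f x *\<^sub>R gradient \<psi> x = 0" "\<psi> x *\<^sub>R g x = 0" using K(3,4) by simp_all
    qed
    have i2: "integrable lebesgue (\<lambda>x. \<psi> x *\<^sub>R g x)"
      using integrable_test_scaleR[OF \<open>open B\<close> \<psi> loc_g] 
      by (subst (asm) integrable_lebesgue_on_supported[OF B]) (rule K0(2))
    have "(LINT x|lebesgue. f x *\<^sub>R gradient \<psi> x) = - (LINT x|lebesgue. \<psi> x *\<^sub>R g x)"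
    proof (rule euclidean_eqI)
      fix b :: 'a assume b: "b \<in> Basis"
      show "(LINT x|lebesgue. f x *\<^sub>R gradient \<psi> x) \<bullet> b = - (LINT x|lebesgue. \<psi> x *\<^sub>R g x) \<bullet> b"
        using parts[OF \<psi> b] integral_inner_left[OF i1, of b] integral_inner_left[OF i2, of b]
        by simp
    qed
    then show "(LINT x|lebesgue_on B. f x *\<^sub>R gradient \<psi> x) = - (LINT x|lebesgue_on B. \<psi> x *\<^sub>R g x)"
      using integral_lebesgue_on_supported[of B "\<lambda>x. f x *\<^sub>R gradient \<psi> x", OF B K0(1)]
        integral_lebesgue_on_supported[of B "\<lambda>x. \<psi> x *\<^sub>R g x", OF B K0(2)] by simp
  qed
qed

section \<open>Almost everywhere existence of the gradient of the phase field\<close>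

text \<open>
  Tonelli's theorem in disguise: averaging the translates of \<open>N\<close> along \<open>b\<close> replaces the
  decomposition of the space into lines parallel to \<open>b\<close>.
\<close>

lemma null_set_if_countable_on_lines:
  fixes N :: "'a::euclidean_space set"
  assumes N: "N \<in> sets borel" and countable: "\<And>x. countable {t::real. x + t *\<^sub>R b \<in> N}"
  shows "N \<in> null_sets lborel"
proof -
  \<comment> \<open>The weight on \<open>{0..1}\<close> has total mass one, so exchanging the
    integrals returns exactly \<open>emeasure lborel N\<close>.\<close>
  let ?f = "\<lambda>(x::'a) (t::real). indicator N (x + t *\<^sub>R b) * indicator {0..1} t :: ennreal"
  have meas: "case_prod ?f \<in> borel_measurable (lborel \<Otimes>\<^sub>M lborel)"
  proof -
    have [measurable]: "N \<in> sets borel" by fact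
    show ?thesis by measurable
  qed
  have "(\<integral>\<^sup>+ t. ?f x t \<partial>lborel) = 0" for x
  proof -
    have "{t. x + t *\<^sub>R b \<in> N} \<in> null_sets lborel"
      using countable[of x] by (rule countable_imp_null_set_lborel)
    then have "AE t in lborel. t \<notin> {t. x + t *\<^sub>R b \<in> N}" by (rule AE_not_in)
    then have "AE t in lborel. ?f x t = 0" by eventually_elim simp
    then have "(\<integral>\<^sup>+ t. ?f x t \<partial>lborel) = (\<integral>\<^sup>+ t. 0 \<partial>(lborel::real measure))"
      by (rule nn_integral_cong_AE)
    then show ?thesis by simp
  qed
  then have "0 = (\<integral>\<^sup>+ x. (\<integral>\<^sup>+ t. ?f x t \<partial>lborel) \<partial>lborel)" by simp
  also have "\<dots> = (\<integral>\<^sup>+ t. (\<integral>\<^sup>+ x. ?f x t \<partial>lborel) \<partial>lborel)"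
    using lborel_pair.Fubini'[OF meas] by simp
  also have "\<dots> = (\<integral>\<^sup>+ t. emeasure lborel N * indicator {0..1::real} t \<partial>lborel)"
  proof (rule nn_integral_cong)
    fix t :: real
    have "(\<integral>\<^sup>+ x. indicator N (x + t *\<^sub>R b) \<partial>lborel) = (\<integral>\<^sup>+ x. indicator N x \<partial>distr lborel borel ((+) (t *\<^sub>R b)))"
      using N by (subst nn_integral_distr) (simp_all add: add.commute)
    also have "\<dots> = emeasure lborel N" using N by (simp add: lborel_distr_plus)
    finally show "(\<integral>\<^sup>+ x. ?f x t \<partial>lborel) = emeasure lborel N * indicator {0..1} t"
      using N by (subst nn_integral_multc) simp_all
  qed
  also have "\<dots> = emeasure lborel N"
    by (simp add: nn_integral_cmult)
  finally show ?thesis using N by (simp add: null_sets_def)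
qed

text \<open>Every singleton is relatively open in \<open>Z\<close>, so by the Lindelof property
  countably many singletons already cover \<open>Z\<close>.\<close>

lemma countable_if_discrete:
  fixes Z :: "'a::euclidean_space set"
  assumes "\<And>t. t \<in> Z \<Longrightarrow> \<not> t islimpt Z"
  shows "countable Z"
proof -
  have "openin (top_of_set Z) S" if S: "S \<in> (\<lambda>t. {t}) ` Z" for S
  proof -
    obtain t where t: "t \<in> Z" "S = {t}" using S by blast
    then obtain U where "t \<in> U" "open U" "\<forall>y\<in>Z. y \<in> U \<longrightarrow> y = t"
      using assms[OF t(1)] unfolding islimpt_def by blast
    then have "S = Z \<inter> U" using t by blast
    then show ?thesis using \<open>open U\<close> by (simp add: openin_open_Int)
  qed
  then obtain \<F> where "\<F> \<subseteq> (\<lambda>t. {t}) ` Z" "countable \<F>" "\<Union>\<F> = \<Union>((\<lambda>t. {t}) ` Z)"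
    by (rule Lindelof_openin)
  then have "countable (\<Union>\<F>)" by (intro countable_UN[of \<F> "\<lambda>x. x", simplified]) (auto intro: countable_finite)
  then show ?thesis using \<open>\<Union>\<F> = _\<close> by simp
qed

section \<open>The boundary as a null set\<close>

text \<open>Works line by line instead of through the implicit function theorem: a zero of
  \<open>\<rho>\<close> with nonzero derivative along \<open>b\<close> is isolated among the zeros
  on its line, since zeros accumulating there would force that derivative to vanish. The finitely
  many coordinate directions cover the level set.\<close>

lemma null_set_regular_level_set:
  fixes \<rho> :: "'a::euclidean_space \<Rightarrow> real"
  assumes U: "open U" and C1: "Ck_on 1 U \<rho>" and regular: "\<And>y. y \<in> U \<Longrightarrow> gradient \<rho> y \<noteq> 0"
  shows "{y \<in> U. \<rho> y = 0} \<in> null_sets lborel"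
proof -
  have diff: "\<rho> differentiable (at y)" if "y \<in> U" for y using C1 that by simp
  have cont: "continuous_on U \<rho>"
    using diff by (intro differentiable_imp_continuous_on) (simp add: differentiable_on_def differentiable_at_withinI)
  have Z_borel: "{y \<in> U. \<rho> y = 0} \<in> sets borel"
  proof -
    have "open {y \<in> U. \<rho> y \<noteq> 0}"
      using continuous_open_preimage[OF cont U open_Compl[OF closed_singleton[of 0]]]
      by (simp add: Int_def vimage_def)
    moreover have "{y \<in> U. \<rho> y = 0} = U - {y \<in> U. \<rho> y \<noteq> 0}" by auto
    ultimately show ?thesis using U by simp
  qed
  have "{y \<in> U. \<rho> y = 0 \<and> gradient \<rho> y \<bullet> b \<noteq> 0} \<in> null_sets lborel" if b: "b \<in> Basis" for b
  proof (rule null_set_if_countable_on_lines[of _ b])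
    have "continuous_on U (\<lambda>y. gradient \<rho> y \<bullet> b)"
    proof (rule continuous_on_eq)
      show "continuous_on U (\<lambda>x. frechet_derivative \<rho> (at x) b)" using C1 b by simp
    qed (simp add: gradient_inner diff)
    then have "open {y \<in> U. gradient \<rho> y \<bullet> b \<noteq> 0}"
      using continuous_open_preimage[OF _ U open_Compl[OF closed_singleton[of 0]]]
      by (simp add: Int_def vimage_def)
    then have "{y \<in> U. \<rho> y = 0} \<inter> {y \<in> U. gradient \<rho> y \<bullet> b \<noteq> 0} \<in> sets borel"
      using Z_borel by simp
    moreover have "{y \<in> U. \<rho> y = 0} \<inter> {y \<in> U. gradient \<rho> y \<bullet> b \<noteq> 0} = {y \<in> U. \<rho> y = 0 \<and> gradient \<rho> y \<bullet> b \<noteq> 0}"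
      by auto
    ultimately show "{y \<in> U. \<rho> y = 0 \<and> gradient \<rho> y \<bullet> b \<noteq> 0} \<in> sets borel" by simp
    fix x
    define Z where "Z = {t. x + t *\<^sub>R b \<in> {y \<in> U. \<rho> y = 0 \<and> gradient \<rho> y \<bullet> b \<noteq> 0}}"
    have "\<not> t islimpt Z" if "t \<in> Z" for t
    proof
      assume "t islimpt Z"
      then obtain T where T: "\<And>n::nat. T n \<in> Z - {t}" "T \<longlonglongrightarrow> t"
        unfolding islimpt_sequential by blast
      have z: "x + t *\<^sub>R b \<in> U" "\<rho> (x + t *\<^sub>R b) = 0" "gradient \<rho> (x + t *\<^sub>R b) \<bullet> b \<noteq> 0"
        using \<open>t \<in> Z\<close> by (auto simp: Z_def)
      have "((\<lambda>t. \<rho> (x + t *\<^sub>R b)) has_derivative (\<lambda>s. gradient \<rho> (x + t *\<^sub>R b) \<bullet> (s *\<^sub>R b))) (at t)"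
        by (rule has_derivative_compose[where f="\<lambda>t. x + t *\<^sub>R b" and g=\<rho>])
          (use has_derivative_gradient[OF diff[OF z(1)]] in \<open>auto intro!: derivative_eq_intros\<close>)
      then have "((\<lambda>t. \<rho> (x + t *\<^sub>R b)) has_real_derivative (gradient \<rho> (x + t *\<^sub>R b) \<bullet> b)) (at t)"
        by (simp add: has_field_derivative_def mult_commute_abs)
      then have "((\<lambda>s. (\<rho> (x + s *\<^sub>R b) - \<rho> (x + t *\<^sub>R b)) / (s - t)) \<longlongrightarrow> gradient \<rho> (x + t *\<^sub>R b) \<bullet> b) (at t)"
        by (simp add: has_field_derivative_iff)
      moreover have "filterlim T (at t) sequentially"
        using T by (auto simp: filterlim_at)
      ultimately have "(\<lambda>n. (\<rho> (x + T n *\<^sub>R b) - \<rho> (x + t *\<^sub>R b)) / (T n - t)) \<longlonglongrightarrow> gradient \<rho> (x + t *\<^sub>R b) \<bullet> b"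
        by (rule filterlim_compose)
      moreover have "\<rho> (x + T n *\<^sub>R b) = 0" for n using T(1)[of n] by (simp add: Z_def)
      ultimately show False using z(2,3) by (simp add: LIMSEQ_const_iff)
    qed
    then show "countable {t. x + t *\<^sub>R b \<in> {y \<in> U. \<rho> y = 0 \<and> gradient \<rho> y \<bullet> b \<noteq> 0}}"
      unfolding Z_def[symmetric] by (rule countable_if_discrete)
  qed
  then have "(\<Union>b\<in>Basis. {y \<in> U. \<rho> y = 0 \<and> gradient \<rho> y \<bullet> b \<noteq> 0}) \<in> null_sets lborel"
    by (intro null_sets_UN') (auto simp: countable_finite)
  moreover have "(\<Union>b\<in>Basis. {y \<in> U. \<rho> y = 0 \<and> gradient \<rho> y \<bullet> b \<noteq> 0}) = {y \<in> U. \<rho> y = 0}"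
  proof -
    have "\<exists>b\<in>Basis. gradient \<rho> y \<bullet> b \<noteq> 0" if "y \<in> U" for y
      using regular[OF that] euclidean_all_zero_iff[of "gradient \<rho> y"] by simp
    then show ?thesis by fast
  qed
  ultimately show ?thesis by simp
qed

lemma null_set_C1_frontier:
  fixes \<Omega> :: "'a::euclidean_space set"
  assumes "open \<Omega>" "C1_boundary \<Omega>"
  shows "frontier \<Omega> \<in> null_sets lborel"
proof -
  have "negligible (frontier \<Omega>)"
  proof (rule iffD2[OF locally_negligible_alt], rule ballI)
    fix x assume x: "x \<in> frontier \<Omega>"
    then obtain U \<rho> where U: "open U" "x \<in> U" "Ck_on 1 U \<rho>" "\<forall>y\<in>U. gradient \<rho> y \<noteq> 0"
        and eq: "\<Omega> \<inter> U = {y \<in> U. \<rho> y < 0}"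
      using assms(2) unfolding C1_boundary_def by meson
    have "\<rho> y = 0" if y: "y \<in> frontier \<Omega>" "y \<in> U" for y
    proof -
      have "y \<notin> \<Omega>" using y(1) assms(1) by (simp add: frontier_def interior_open)
      then have "\<rho> y \<ge> 0" using eq y(2) by force
      moreover have "\<not> \<rho> y > 0"
      proof
        assume pos: "\<rho> y > 0"
        \<comment> \<open>If \<open>\<rho>\<close> were positive at \<open>y\<close>, it would be
          positive nearby, and no points of \<open>\<Omega>\<close> could approach
          \<open>y\<close>.\<close>
        have "isCont \<rho> y" using U(3) y(2) by (auto intro: differentiable_imp_continuous_within)
        then have "\<forall>\<^sub>F z in nhds y. \<rho> z > 0"
          using pos by (simp add: isCont_def tendsto_at_iff_tendsto_nhds order_tendstoD)
        then obtain V where V: "open V" "y \<in> V" "\<And>z. z \<in> V \<Longrightarrow> \<rho> z > 0"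
          unfolding eventually_nhds by blast
        have "y \<in> closure \<Omega>" using y(1) by (simp add: frontier_def)
        then have "\<Omega> \<inter> (U \<inter> V) \<noteq> {}"
          using open_Int_closure_eq_empty[of "U \<inter> V" \<Omega>] U(1) V(1,2) y(2) by (auto simp: open_Int)
        then obtain z where "z \<in> \<Omega> \<inter> U" "z \<in> V" by blast
        with eq V(3)[of z] show False by force
      qed
      ultimately show ?thesis by simp
    qed
    then have "frontier \<Omega> \<inter> U \<subseteq> {y \<in> U. \<rho> y = 0}" by blast
    moreover have "negligible {y \<in> U. \<rho> y = 0}"
      using null_set_regular_level_set[OF U(1,3)] U(4) by (simp add: negligible_iff_null_sets null_sets_completionI)
    ultimately have "negligible (frontier \<Omega> \<inter> U)" by (rule negligible_subset[rotated])
    then show "\<exists>V. openin (top_of_set (frontier \<Omega>)) V \<and> x \<in> V \<and> negligible V"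
      using x U(1,2) by (intro exI[of _ "frontier \<Omega> \<inter> U"]) (simp add: openin_open_Int)
  qed
  then show ?thesis
    by (simp add: negligible_iff_null_sets null_sets_completion_iff frontier_closed)
qed

section \<open>Partial derivatives of the squared distance almost everywhere\<close>

text \<open>\<open>m\<close> selects a subgradient of the convex function \<open>f\<close>, so it is
  monotone with countably many discontinuities; at the other points the second difference lies
  between 0 and \<open>r * (m (t + r) - m (t - r))\<close>. The conclusion mentions only
  \<open>f\<close>, so that in higher dimension the exceptional set is Borel without any
  measurability of the subgradient.\<close>

lemma symmetric_quotient_tendsto_0:
  fixes f m :: "real \<Rightarrow> real"
  assumes sub: "\<And>s t. f s \<ge> f t + m t * (s - t)"
  shows "countable {t. \<not> (\<lambda>k. real (Suc k) * (f (t + inverse (real (Suc k))) + f (t - inverse (real (Suc k))) - 2 * f t)) \<longlonglongrightarrow> 0}"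
proof (rule countable_subset)
  have "mono m"
  proof (rule monoI)
    fix s t :: real assume "s \<le> t"
    have "(m t - m s) * (t - s) \<ge> 0" using sub[of s t] sub[of t s] by (simp add: algebra_simps)
    then show "m s \<le> m t" using \<open>s \<le> t\<close> by (cases "s = t") (auto simp: zero_le_mult_iff)
  qed
  then show "countable {t. \<not> isCont m t}" by (rule mono_ctble_discont)
  have "(\<lambda>k. real (Suc k) * (f (t + inverse (real (Suc k))) + f (t - inverse (real (Suc k))) - 2 * f t)) \<longlonglongrightarrow> 0"
    if "isCont m t" for t
  proof -
    define r where "r = (\<lambda>k. inverse (real (Suc k)))"
    have r: "r \<longlonglongrightarrow> 0" "\<And>k. r k > 0" unfolding r_def using LIMSEQ_inverse_real_of_nat by auto
    have "(\<lambda>k. m (t + r k)) \<longlonglongrightarrow> m t"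
      by (rule isCont_tendsto_compose[OF that]) (use tendsto_add[OF tendsto_const[of t] r(1)] in simp)
    moreover have "(\<lambda>k. m (t - r k)) \<longlonglongrightarrow> m t"
      by (rule isCont_tendsto_compose[OF that]) (use tendsto_diff[OF tendsto_const[of t] r(1)] in simp)
    ultimately have up: "(\<lambda>k. m (t + r k) - m (t - r k)) \<longlonglongrightarrow> 0"
      using tendsto_diff by fastforce
    have "(\<lambda>k. inverse (r k) * (f (t + r k) + f (t - r k) - 2 * f t)) \<longlonglongrightarrow> 0"
    proof (rule tendsto_sandwich[OF _ _ tendsto_const up])
      have "f (t + r k) + f (t - r k) - 2 * f t \<ge> 0" for k
        using sub[of t "t + r k"] sub[of t "t - r k"] by simp
      then show "\<forall>\<^sub>F k in sequentially. 0 \<le> inverse (r k) * (f (t + r k) + f (t - r k) - 2 * f t)"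
        using r(2) by (simp add: less_imp_le)
      have "f (t + r k) + f (t - r k) - 2 * f t \<le> r k * (m (t + r k) - m (t - r k))" for k
        using sub[of "t + r k" t] sub[of "t - r k" t] by (simp add: algebra_simps)
      then have "inverse (r k) * (f (t + r k) + f (t - r k) - 2 * f t) \<le> m (t + r k) - m (t - r k)" for k
        using r(2)[of k] by (simp add: field_simps)
      then show "\<forall>\<^sub>F k in sequentially. inverse (r k) * (f (t + r k) + f (t - r k) - 2 * f t) \<le> m (t + r k) - m (t - r k)"
        by simp
    qed
    then show ?thesis by (simp add: r_def)
  qed
  then show "{t. \<not> (\<lambda>k. real (Suc k) * (f (t + inverse (real (Suc k))) + f (t - inverse (real (Suc k))) - 2 * f t)) \<longlonglongrightarrow> 0}
      \<subseteq> {t. \<not> isCont m t}" by blast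
qed

text \<open>
  The function \<open>h(x) = |x|\<^sup>2 - dist(x, F)\<^sup>2\<close> is convex, with subgradient \<open>2 y\<close> at \<open>x\<close> for every
  nearest point \<open>y\<close> of \<open>F\<close>; on a line a monotone subgradient is continuous off a countable set.
\<close>

lemma infdist_square_quotient_AE:
  fixes F :: "'a::euclidean_space set" and y :: "'a \<Rightarrow> 'a"
  assumes F: "\<And>x. y x \<in> F" "\<And>x. infdist x F = dist x (y x)"
  shows "AE x in lborel. (\<lambda>k. real (Suc k) * ((infdist (x + inverse (real (Suc k)) *\<^sub>R b) F)\<^sup>2 - (infdist x F)\<^sup>2))
      \<longlonglongrightarrow> 2 * ((x - y x) \<bullet> b)"
proof -
  define h where "h = (\<lambda>x. x \<bullet> x - (infdist x F)\<^sup>2)"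
  define r where "r = (\<lambda>k. inverse (real (Suc k)))"
  define q where "q = (\<lambda>k x. real (Suc k) * (h (x + r k *\<^sub>R b) + h (x - r k *\<^sub>R b) - 2 * h x))"
  \<comment> \<open>As a function of z, |z|^2 - |z - y x|^2 is affine, lies below \<open>h\<close>
    and touches it at \<open>x\<close>; this is the subgradient inequality.\<close>
  have sub: "h z \<ge> h x + 2 * (y x \<bullet> (z - x))" for x z
  proof -
    have "infdist z F \<le> dist z (y x)" using F(1) by (rule infdist_le)
    then have "(infdist z F)\<^sup>2 \<le> (dist z (y x))\<^sup>2" by (simp add: power_mono infdist_nonneg)
    then show ?thesis
      by (simp add: h_def F(2)[of x] dist_norm power2_norm_eq_inner algebra_simps inner_commute)
  qed
  have hc: "continuous_on UNIV h" unfolding h_def by (intro continuous_intros)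
  have qc: "continuous_on UNIV (q k)" for k
    unfolding q_def by (intro continuous_intros continuous_on_compose2[OF hc]) auto
  define E where "E = {x. \<not> (\<lambda>k. q k x) \<longlonglongrightarrow> 0}"
  have "E \<in> null_sets lborel"
  proof (rule null_set_if_countable_on_lines[of _ b])
    have [measurable]: "q k \<in> borel_measurable borel" for k
      using qc by (rule borel_measurable_continuous_onI)
    \<comment> \<open>Convergence is recast as the Cauchy property together with the value of
      \<open>lim\<close>, which exhibits \<open>E\<close> as a measurable set.\<close>
    have "X \<longlonglongrightarrow> 0 \<longleftrightarrow> Cauchy X \<and> lim X = 0" for X :: "nat \<Rightarrow> real"
      unfolding Cauchy_convergent_iff convergent_LIMSEQ_iff by (metis limI)
    then have "E = {x \<in> space borel. \<not> (Cauchy (\<lambda>k. q k x) \<and> lim (\<lambda>k. q k x) = 0)}"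
      by (simp add: E_def)
    also have "\<dots> \<in> sets borel" by measurable
    finally show "E \<in> sets borel" .
    fix x
    have "countable {t. \<not> (\<lambda>k. real (Suc k) * (h (x + (t + inverse (real (Suc k))) *\<^sub>R b) +
        h (x + (t - inverse (real (Suc k))) *\<^sub>R b) - 2 * h (x + t *\<^sub>R b))) \<longlonglongrightarrow> 0}"
    proof (rule symmetric_quotient_tendsto_0)
      show "h (x + t *\<^sub>R b) + 2 * (y (x + t *\<^sub>R b) \<bullet> b) * (s - t) \<le> h (x + s *\<^sub>R b)" for s t
        using sub[of "x + t *\<^sub>R b" "x + s *\<^sub>R b"] by (simp add: scaleR_diff_left[symmetric] mult_ac)
    qed
    then show "countable {t. x + t *\<^sub>R b \<in> E}"
      by (simp add: E_def q_def r_def algebra_simps)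
  qed
  then have "AE x in lborel. x \<notin> E" by (rule AE_not_in)
  then show ?thesis
  proof eventually_elim
    case (elim x)
    then have q0: "(\<lambda>k. q k x) \<longlonglongrightarrow> 0" by (simp add: E_def)
    have r: "r \<longlonglongrightarrow> 0" "\<And>k. real (Suc k) * r k = 1" "\<And>k. r k > 0"
      unfolding r_def using LIMSEQ_inverse_real_of_nat by auto
    \<comment> \<open>By the subgradient inequality the forward quotient exceeds
      \<open>2 * (y x \<bullet> b)\<close> and the backward one exceeds
      \<open>- 2 * (y x \<bullet> b)\<close> by nonnegative amounts that add up to
      \<open>q k x\<close>; since the sum tends to 0, so does the forward excess.\<close>
    have "(\<lambda>k. real (Suc k) * (h (x + r k *\<^sub>R b) - h x) - 2 * (y x \<bullet> b)) \<longlonglongrightarrow> 0"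
    proof (rule tendsto_sandwich[OF _ _ tendsto_const q0])
      have 1: "real (Suc k) * (h (x + r k *\<^sub>R b) - h x) \<ge> 2 * (y x \<bullet> b)" for k
      proof -
        have "real (Suc k) * (2 * (r k * (y x \<bullet> b))) \<le> real (Suc k) * (h (x + r k *\<^sub>R b) - h x)"
          using sub[of x "x + r k *\<^sub>R b"] by (intro mult_left_mono) auto
        moreover have "real (Suc k) * (2 * (r k * (y x \<bullet> b))) = (real (Suc k) * r k) * (2 * (y x \<bullet> b))"
          by (simp only: mult_ac)
        ultimately show ?thesis unfolding r(2) by linarith
      qed
      have 2: "real (Suc k) * (h (x - r k *\<^sub>R b) - h x) \<ge> - 2 * (y x \<bullet> b)" for k
      proof -
        have "real (Suc k) * (- 2 * (r k * (y x \<bullet> b))) \<le> real (Suc k) * (h (x - r k *\<^sub>R b) - h x)"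
          using sub[of x "x - r k *\<^sub>R b"] by (intro mult_left_mono) auto
        moreover have "real (Suc k) * (- 2 * (r k * (y x \<bullet> b))) = (real (Suc k) * r k) * (- 2 * (y x \<bullet> b))"
          by (simp only: mult_ac)
        ultimately show ?thesis unfolding r(2) by linarith
      qed
      show "\<forall>\<^sub>F k in sequentially. 0 \<le> real (Suc k) * (h (x + r k *\<^sub>R b) - h x) - 2 * (y x \<bullet> b)"
        using 1 by simp
      have qeq: "q k x = real (Suc k) * (h (x + r k *\<^sub>R b) - h x) + real (Suc k) * (h (x - r k *\<^sub>R b) - h x)" for k
        unfolding q_def distrib_left[symmetric] by simp
      have "real (Suc k) * (h (x + r k *\<^sub>R b) - h x) - 2 * (y x \<bullet> b) \<le> q k x" for k
        unfolding qeq using 2[of k] by linarith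
      then show "\<forall>\<^sub>F k in sequentially. real (Suc k) * (h (x + r k *\<^sub>R b) - h x) - 2 * (y x \<bullet> b) \<le> q k x"
        by simp
    qed
    moreover have "(\<lambda>k. 2 * (x \<bullet> b) + r k * (b \<bullet> b)) \<longlonglongrightarrow> 2 * (x \<bullet> b) + 0 * (b \<bullet> b)"
      by (intro tendsto_intros r(1))
    ultimately have lim: "(\<lambda>k. 2 * (x \<bullet> b) + r k * (b \<bullet> b) -
        (real (Suc k) * (h (x + r k *\<^sub>R b) - h x) - 2 * (y x \<bullet> b)) - 2 * (y x \<bullet> b))
        \<longlonglongrightarrow> 2 * (x \<bullet> b) + 0 * (b \<bullet> b) - 0 - 2 * (y x \<bullet> b)"
      by (intro tendsto_diff tendsto_const)
    have eqk: "real (Suc k) * ((infdist (x + r k *\<^sub>R b) F)\<^sup>2 - (infdist x F)\<^sup>2)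
        = 2 * (x \<bullet> b) + r k * (b \<bullet> b) - (real (Suc k) * (h (x + r k *\<^sub>R b) - h x) - 2 * (y x \<bullet> b)) - 2 * (y x \<bullet> b)" for k
    proof -
      have "(infdist (x + r k *\<^sub>R b) F)\<^sup>2 - (infdist x F)\<^sup>2
          = r k * (2 * (x \<bullet> b) + r k * (b \<bullet> b)) - (h (x + r k *\<^sub>R b) - h x)"
        unfolding h_def by (simp add: algebra_simps inner_commute)
      then have "real (Suc k) * ((infdist (x + r k *\<^sub>R b) F)\<^sup>2 - (infdist x F)\<^sup>2)
          = (real (Suc k) * r k) * (2 * (x \<bullet> b) + r k * (b \<bullet> b)) - real (Suc k) * (h (x + r k *\<^sub>R b) - h x)"
        by (simp only: right_diff_distrib mult.assoc)
      then show ?thesis unfolding r(2) by simp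
    qed
    have "(\<lambda>k. real (Suc k) * ((infdist (x + r k *\<^sub>R b) F)\<^sup>2 - (infdist x F)\<^sup>2))
        \<longlonglongrightarrow> 2 * (x \<bullet> b) + 0 * (b \<bullet> b) - 0 - 2 * (y x \<bullet> b)"
      unfolding eqk by (rule lim)
    moreover have "2 * (x \<bullet> b) + 0 * (b \<bullet> b) - 0 - 2 * (y x \<bullet> b) = 2 * ((x - y x) \<bullet> b)"
      by (simp add: inner_diff_left)
    ultimately show ?case by (simp only: r_def)
  qed
qed

section \<open>Lipschitz estimates for the signed distance and the phase field\<close>

text \<open>A ball that misses the frontier is connected, so it lies on one side. This keeps the
  sign in \<open>signed_distance\<close> constant near a point off the frontier.\<close>

lemma same_side_of_frontier:
  fixes \<Omega> :: "'a::euclidean_space set"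
  assumes "z \<in> ball x (infdist x (frontier \<Omega>))"
  shows "z \<in> \<Omega> \<longleftrightarrow> x \<in> \<Omega>"
proof (rule ccontr)
  assume neq: "\<not> (z \<in> \<Omega> \<longleftrightarrow> x \<in> \<Omega>)"
  let ?B = "ball x (infdist x (frontier \<Omega>))"
  have "dist x z < infdist x (frontier \<Omega>)" using assms by simp
  then have "x \<in> ?B" using zero_le_dist[of x z] by (simp del: zero_le_dist)
  then have "?B \<inter> \<Omega> \<noteq> {}" "?B - \<Omega> \<noteq> {}" using assms neq by blast+
  then have "?B \<inter> frontier \<Omega> \<noteq> {}" by (rule connected_Int_frontier[OF connected_ball])
  then obtain w where "w \<in> frontier \<Omega>" "dist x w < infdist x (frontier \<Omega>)" by auto
  then show False using infdist_le[of w "frontier \<Omega>" x] by simp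
qed

text \<open>The change of sign does no harm: a segment joining points on opposite sides crosses the
  frontier, and the crossing point splits its length into two pieces that dominate the two
  distances.\<close>

lemma signed_distance_Lipschitz:
  fixes \<Omega> :: "'a::euclidean_space set"
  shows "\<bar>signed_distance \<Omega> x - signed_distance \<Omega> y\<bar> \<le> norm (x - y)"
proof -
  have across: "infdist u (frontier \<Omega>) + infdist v (frontier \<Omega>) \<le> norm (u - v)"
    if "u \<in> \<Omega>" "v \<notin> \<Omega>" for u v
  proof -
    have "closed_segment u v \<inter> frontier \<Omega> \<noteq> {}"
      using that by (intro connected_Int_frontier connected_segment) auto
    then obtain w where w: "w \<in> closed_segment u v" "w \<in> frontier \<Omega>" by blast
    have "dist u v = dist u w + dist w v"
      using w(1) by (simp add: between_mem_segment[symmetric] between)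
    then show ?thesis
      using infdist_le[OF w(2), of u] infdist_le[OF w(2), of v] by (simp add: dist_norm norm_minus_commute)
  qed
  have "\<bar>infdist x (frontier \<Omega>) - infdist y (frontier \<Omega>)\<bar> \<le> norm (x - y)"
    using infdist_triangle_abs[of x "frontier \<Omega>" y] by (simp add: dist_norm)
  moreover have "\<bar>infdist x (frontier \<Omega>) + infdist y (frontier \<Omega>)\<bar> \<le> norm (x - y)" if "(x \<in> \<Omega>) \<noteq> (y \<in> \<Omega>)"
    using across[of x y] across[of y x] that infdist_nonneg[of x "frontier \<Omega>"] infdist_nonneg[of y "frontier \<Omega>"]
    by (auto simp: norm_minus_commute)
  ultimately show ?thesis
    by (auto simp: signed_distance_def)
qed

lemma tanh_Lipschitz: "\<bar>tanh a - tanh b\<bar> \<le> \<bar>a - b\<bar>" for a b :: real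
proof -
  have "norm (tanh a - tanh b) \<le> 1 * norm (a - b)"
  proof (rule field_differentiable_bound[of UNIV tanh "\<lambda>x. 1 - tanh x ^ 2"])
    show "(tanh has_field_derivative 1 - (tanh x)\<^sup>2) (at x within UNIV)" for x :: real
      by (auto intro!: derivative_eq_intros)
    show "norm (1 - (tanh x)\<^sup>2) \<le> 1" for x :: real
    proof -
      have "(tanh x)\<^sup>2 \<le> 1" using tanh_real_lt_1[of x] tanh_real_gt_neg1[of x] by (simp add: abs_square_le_1 abs_le_iff)
      then show ?thesis by simp
    qed
  qed auto
  then show ?thesis by simp
qed

lemma phase_field_bounds: "0 < phase_field \<Omega> \<epsilon> x" "phase_field \<Omega> \<epsilon> x < 1"
  using tanh_real_lt_1[of "3 * signed_distance \<Omega> x / \<epsilon>"] tanh_real_gt_neg1[of "3 * signed_distance \<Omega> x / \<epsilon>"]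
  by (simp_all add: phase_field_def)

lemma phase_field_Lipschitz:
  assumes "\<epsilon> > 0"
  shows "\<bar>phase_field \<Omega> \<epsilon> x - phase_field \<Omega> \<epsilon> y\<bar> \<le> 3 / \<epsilon> * norm (x - y)"
proof -
  let ?r = "signed_distance \<Omega>"
  have "\<bar>tanh (3 * ?r x / \<epsilon>) - tanh (3 * ?r y / \<epsilon>)\<bar> \<le> \<bar>3 * ?r x / \<epsilon> - 3 * ?r y / \<epsilon>\<bar>"
    by (rule tanh_Lipschitz)
  also have "\<dots> = 3 / \<epsilon> * \<bar>?r x - ?r y\<bar>"
  proof -
    have "3 * ?r x / \<epsilon> - 3 * ?r y / \<epsilon> = 3 / \<epsilon> * (?r x - ?r y)"
      by (simp add: right_diff_distrib diff_divide_distrib)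
    then have "\<bar>3 * ?r x / \<epsilon> - 3 * ?r y / \<epsilon>\<bar> = \<bar>3 / \<epsilon>\<bar> * \<bar>?r x - ?r y\<bar>"
      by (simp only: abs_mult)
    also have "\<bar>3 / \<epsilon>\<bar> = 3 / \<epsilon>" using assms by simp
    finally show ?thesis .
  qed
  also have "\<dots> \<le> 3 / \<epsilon> * norm (x - y)"
    using assms by (intro mult_left_mono signed_distance_Lipschitz) auto
  finally have "\<bar>tanh (3 * ?r x / \<epsilon>) - tanh (3 * ?r y / \<epsilon>)\<bar> \<le> 3 / \<epsilon> * norm (x - y)" .
  \<comment> \<open>The factor 1/2 of the phase field is given away here, whence the constant
    \<open>3 / \<epsilon>\<close>.\<close>
  moreover have "\<bar>d\<bar> \<le> R" if "\<bar>t\<bar> \<le> R" "d = - t / 2" for t d R :: real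
    using that by linarith
  moreover have "phase_field \<Omega> \<epsilon> x - phase_field \<Omega> \<epsilon> y = - (tanh (3 * ?r x / \<epsilon>) - tanh (3 * ?r y / \<epsilon>)) / 2"
    by (simp add: phase_field_def diff_divide_distrib)
  ultimately show ?thesis by metis
qed

lemma phase_field_gradient:
  fixes \<Omega> :: "'a::euclidean_space set"
  assumes "open \<Omega>" "\<Omega> \<noteq> {}" "bounded \<Omega>" "C1_boundary \<Omega>" "\<epsilon> > 0"
  obtains g M where "g \<in> borel_measurable lebesgue"
    "\<And>B. open B \<Longrightarrow> has_weak_gradient B (phase_field \<Omega> \<epsilon>) g"
    "AE x in lebesgue. norm (g x) \<le> M" "AE x in lebesgue. g x \<noteq> 0"
proof -
  define F where "F = frontier \<Omega>"
  \<comment> \<open>A nonempty set that is not the whole space has a nonempty frontier, and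
    boundedness excludes the whole space; so nearest points exist.\<close>
  have F: "closed F" "F \<noteq> {}"
    using assms(2,3) not_bounded_UNIV[where 'a='a] frontier_eq_empty[of \<Omega>] by (auto simp: F_def)
  have "\<exists>y. y \<in> F \<and> infdist x F = dist x y" for x
  proof -
    obtain y where "y \<in> F" "infdist x F = dist x y"
      by (rule infdist_attains_inf[OF F, of x])
    then show ?thesis by (intro exI[of _ y] conjI)
  qed
  then obtain y where "\<forall>x. y x \<in> F \<and> infdist x F = dist x (y x)"
    using choice[of "\<lambda>x y. y \<in> F \<and> infdist x F = dist x y"] by auto
  then have y: "\<And>x. y x \<in> F" "\<And>x. infdist x F = dist x (y x)" by (simp_all only:)
  let ?\<phi> = "phase_field \<Omega> \<epsilon>"
  define r where "r = (\<lambda>k. inverse (real (Suc k)))"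
  define q where "q = (\<lambda>k b x. real (Suc k) * (?\<phi> (x + r k *\<^sub>R b) - ?\<phi> x))"
  \<comment> \<open>Defined by limits of quotients, not by a formula in the nearest point
    \<open>y x\<close>: this makes \<open>g\<close> Borel measurable although \<open>y\<close> is
    only a choice function.\<close>
  define g where "g = (\<lambda>x. \<Sum>b\<in>Basis. lim (\<lambda>k. q k b x) *\<^sub>R b)"
  have g_inner: "g x \<bullet> b = lim (\<lambda>k. q k b x)" if "b \<in> Basis" for x b
    using that by (simp add: g_def)
  have \<phi>c: "continuous_on S ?\<phi>" for S
    using phase_field_Lipschitz[OF assms(5)] by (rule Lipschitz_imp_continuous_on)
  have key: "\<exists>D. D \<noteq> 0 \<and> (\<forall>b\<in>Basis. (\<lambda>k. q k b x) \<longlonglongrightarrow> D * ((x - y x) \<bullet> b))"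
    if x: "x \<notin> F" and lim: "\<forall>b\<in>Basis. (\<lambda>k. real (Suc k) * ((infdist (x + r k *\<^sub>R b) F)\<^sup>2 - (infdist x F)\<^sup>2)) \<longlonglongrightarrow> 2 * ((x - y x) \<bullet> b)" for x
  proof -
    have pos: "infdist x F > 0"
      using infdist_pos_not_in_closed[OF F x] .
    \<comment> \<open>With the sign frozen by \<open>\<sigma>\<close>, \<open>?\<phi>\<close> is
      near \<open>x\<close> the function \<open>\<Phi>\<close> of the squared distance, and
      \<open>sqrt\<close> is differentiable at \<open>a > 0\<close>.\<close>
    define \<sigma> where "\<sigma> = (if x \<in> \<Omega> then - 1 else 1 :: real)"
    define \<Phi> where "\<Phi> = (\<lambda>u. (1 - tanh (3 * (\<sigma> * sqrt u) / \<epsilon>)) / 2)"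
    define a where "a = (infdist x F)\<^sup>2"
    define D where "D = - ((1 - (tanh (3 * (\<sigma> * sqrt a) / \<epsilon>))\<^sup>2) * (3 * (\<sigma> * (inverse (sqrt a) / 2)) / \<epsilon>)) / 2"
    have a: "a > 0" using pos by (simp add: a_def)
    have "(\<Phi> has_real_derivative D) (at a)"
      unfolding \<Phi>_def D_def using a assms(5)
      by (auto intro!: derivative_eq_intros simp: field_simps)
    have "(tanh (3 * (\<sigma> * sqrt a) / \<epsilon>))\<^sup>2 < 1"
      using tanh_real_lt_1[of "3 * (\<sigma> * sqrt a) / \<epsilon>"] tanh_real_gt_neg1[of "3 * (\<sigma> * sqrt a) / \<epsilon>"]
      by (simp add: abs_square_less_1 abs_less_iff)
    then have D0: "D \<noteq> 0" using a assms(5) by (auto simp: D_def \<sigma>_def)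
    have \<Phi>: "?\<phi> z = \<Phi> ((infdist z F)\<^sup>2)" if "z \<in> ball x (infdist x F)" for z
      using same_side_of_frontier[of z x \<Omega>] that
      by (simp add: phase_field_def signed_distance_def \<Phi>_def \<sigma>_def F_def[symmetric] infdist_nonneg)
    have "(\<lambda>k. q k b x) \<longlonglongrightarrow> D * (2 * ((x - y x) \<bullet> b))" if b: "b \<in> Basis" for b
    proof -
      have "(\<lambda>k. r k *\<^sub>R b) \<longlonglongrightarrow> 0" unfolding r_def by (rule inverse_Suc_tendsto_0)
      then have xk: "(\<lambda>k. x + r k *\<^sub>R b) \<longlonglongrightarrow> x"
        using tendsto_add[OF tendsto_const[of x]] by fastforce
      then have "(\<lambda>k. (infdist (x + r k *\<^sub>R b) F)\<^sup>2) \<longlonglongrightarrow> a"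
        unfolding a_def by (intro tendsto_intros)
      then have "(\<lambda>k. real (Suc k) * (\<Phi> ((infdist (x + r k *\<^sub>R b) F)\<^sup>2) - \<Phi> a)) \<longlonglongrightarrow> D * (2 * ((x - y x) \<bullet> b))"
        using lim b unfolding a_def[symmetric]
        by (intro sequential_chain_rule[OF \<open>(\<Phi> has_real_derivative D) (at a)\<close>]) auto
      moreover have "\<forall>\<^sub>F k in sequentially. x + r k *\<^sub>R b \<in> ball x (infdist x F)"
        using xk pos by (intro topological_tendstoD) auto
      then have "\<forall>\<^sub>F k in sequentially. real (Suc k) * (\<Phi> ((infdist (x + r k *\<^sub>R b) F)\<^sup>2) - \<Phi> a) = q k b x"
        by eventually_elim (use \<Phi> pos in \<open>simp add: q_def a_def\<close>)
      ultimately show ?thesis by (rule Lim_transform_eventually)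
    qed
    then show ?thesis
      \<comment> \<open>\<open>2 * D\<close> takes in the 2 from differentiating a square; it is
        nonzero because |tanh| < 1.\<close>
      using D0 by (intro exI[of _ "2 * D"]) (simp add: mult_ac)
  qed
  have "AE x in lborel. x \<notin> F"
    using null_set_C1_frontier[OF assms(1,4)] unfolding F_def by (rule AE_not_in)
  moreover have "AE x in lborel. \<forall>b\<in>Basis. (\<lambda>k. real (Suc k) * ((infdist (x + r k *\<^sub>R b) F)\<^sup>2 - (infdist x F)\<^sup>2)) \<longlonglongrightarrow> 2 * ((x - y x) \<bullet> b)"
    unfolding r_def by (subst AE_ball_countable) (simp_all add: countable_finite infdist_square_quotient_AE[OF y] del: of_nat_Suc)
  ultimately have "AE x in lborel. x \<notin> F \<and> (\<exists>D. D \<noteq> 0 \<and> (\<forall>b\<in>Basis. (\<lambda>k. q k b x) \<longlonglongrightarrow> D * ((x - y x) \<bullet> b)))"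
    by eventually_elim (use key in simp)
  then have ae: "AE x in lebesgue. x \<notin> F \<and> (\<exists>D. D \<noteq> 0 \<and> (\<forall>b\<in>Basis. (\<lambda>k. q k b x) \<longlonglongrightarrow> D * ((x - y x) \<bullet> b)))"
    by (rule AE_completion)
  have gm: "g \<in> borel_measurable lebesgue"
  proof -
    have "q k b \<in> borel_measurable borel" for k b
      unfolding q_def
      by (intro borel_measurable_continuous_onI continuous_intros \<phi>c continuous_on_compose2[OF \<phi>c[of UNIV]]) auto
    then have "g \<in> borel_measurable borel"
      unfolding g_def by (intro borel_measurable_sum borel_measurable_scaleR borel_measurable_lim_metric borel_measurable_const)
    then show ?thesis by (simp add: measurable_completion)
  qed
  have lim: "AE x in lebesgue. (\<lambda>k. real (Suc k) * (?\<phi> (x + inverse (real (Suc k)) *\<^sub>R b) - ?\<phi> x)) \<longlonglongrightarrow> g x \<bullet> b"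
    if b: "b \<in> Basis" for b
    using ae
  proof eventually_elim
    case (elim x)
    then obtain D where "(\<lambda>k. q k b x) \<longlonglongrightarrow> D * ((x - y x) \<bullet> b)" using b by blast
    then have "(\<lambda>k. q k b x) \<longlonglongrightarrow> g x \<bullet> b" unfolding g_inner[OF b] by (simp add: limI)
    then show ?case by (simp only: q_def r_def)
  qed
  have "AE x in lebesgue. g x \<noteq> 0"
    using ae
  proof eventually_elim
    case (elim x)
    then obtain D where D: "D \<noteq> 0" "\<forall>b\<in>Basis. (\<lambda>k. q k b x) \<longlonglongrightarrow> D * ((x - y x) \<bullet> b)" by blast
    have "g x = D *\<^sub>R (x - y x)"
      by (rule euclidean_eqI) (use D(2) in \<open>simp add: g_inner limI\<close>)
    moreover have "x \<noteq> y x" using elim y(1)[of x] by metis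
    ultimately show ?case using D(1) by simp
  qed
  moreover have "AE x in lebesgue. norm (g x) \<le> real DIM('a) * (3 / \<epsilon>)"
    by (rule has_weak_gradient_Lipschitz(1)[OF open_UNIV phase_field_Lipschitz[OF assms(5)] gm lim])
  moreover have "has_weak_gradient B ?\<phi> g" if "open B" for B
    by (rule has_weak_gradient_Lipschitz(2)[OF that phase_field_Lipschitz[OF assms(5)] gm lim])
  ultimately show thesis using that[OF gm] by simp
qed

section \<open>Square integrable functions\<close>

lemma borel_measurable_lebesgue_on_AE:
  fixes f g :: "'a::euclidean_space \<Rightarrow> 'b::euclidean_space"
  assumes "S \<in> sets lebesgue" "g \<in> borel_measurable (lebesgue_on S)" "AE x in lebesgue_on S. g x = f x"
  shows "f \<in> borel_measurable (lebesgue_on S)"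
proof -
  have "(\<lambda>x. indicator S x *\<^sub>R f x) \<in> borel_measurable lebesgue"
  proof (rule borel_measurable_AE)
    show "(\<lambda>x. indicator S x *\<^sub>R g x) \<in> borel_measurable lebesgue"
      using assms(1,2) by (simp add: borel_measurable_restrict_space_iff)
    have "AE x in lebesgue. x \<in> S \<longrightarrow> g x = f x"
      using assms(1,3) by (simp add: AE_restrict_space_iff)
    then show "AE x in lebesgue. indicator S x *\<^sub>R g x = indicator S x *\<^sub>R f x"
      by eventually_elim (auto simp: indicator_def)
  qed
  then show ?thesis using assms(1) by (simp add: borel_measurable_restrict_space_iff)
qed

text \<open>Integrands containing \<open>weak_grad\<close> enter as \<open>f\<close>; completeness
  of Lebesgue measure transfers measurability from the explicit representative \<open>g\<close>, so
  it need not be checked for \<open>f\<close>.\<close>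

lemma integral_lebesgue_on_cong_AE:
  fixes f g :: "'a::euclidean_space \<Rightarrow> 'b::euclidean_space"
  assumes "S \<in> sets lebesgue" "g \<in> borel_measurable (lebesgue_on S)" "AE x in lebesgue_on S. f x = g x"
  shows "(LINT x|lebesgue_on S. f x) = (LINT x|lebesgue_on S. g x)"
proof (rule integral_cong_AE)
  show "f \<in> borel_measurable (lebesgue_on S)"
    using assms by (intro borel_measurable_lebesgue_on_AE[of S g f]) (auto simp: eq_commute)
qed (use assms in auto)

lemma L2_dominated:
  fixes f :: "'a::euclidean_space \<Rightarrow> 'b::euclidean_space" and h :: "'a \<Rightarrow> 'c::euclidean_space"
  assumes "f \<in> L2 B" "h \<in> borel_measurable (lebesgue_on B)" "AE x in lebesgue_on B. norm (h x) \<le> K * norm (f x)"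
  shows "h \<in> L2 B"
proof -
  have "integrable (lebesgue_on B) (\<lambda>x. (norm (h x))\<^sup>2)"
  proof (rule Bochner_Integration.integrable_bound)
    show "integrable (lebesgue_on B) (\<lambda>x. K\<^sup>2 * (norm (f x))\<^sup>2)" using assms(1) by (simp add: L2_def)
    show "(\<lambda>x. (norm (h x))\<^sup>2) \<in> borel_measurable (lebesgue_on B)" using assms(2) by measurable
    show "AE x in lebesgue_on B. norm ((norm (h x))\<^sup>2) \<le> norm (K\<^sup>2 * (norm (f x))\<^sup>2)"
      using assms(3)
    proof eventually_elim
      case (elim x)
      then have "(norm (h x))\<^sup>2 \<le> (K * norm (f x))\<^sup>2" by (intro power_mono) auto
      then show ?case by (simp add: power_mult_distrib)
    qed
  qed
  then show ?thesis using assms(2) by (simp add: L2_def)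
qed

lemma L2_add:
  fixes f g :: "'a::euclidean_space \<Rightarrow> 'b::euclidean_space"
  assumes "f \<in> L2 B" "g \<in> L2 B"
  shows "(\<lambda>x. f x + g x) \<in> L2 B"
proof -
  have m: "f \<in> borel_measurable (lebesgue_on B)" "g \<in> borel_measurable (lebesgue_on B)"
    using assms by (auto simp: L2_def)
  have "integrable (lebesgue_on B) (\<lambda>x. (norm (f x + g x))\<^sup>2)"
  proof (rule Bochner_Integration.integrable_bound)
    show "integrable (lebesgue_on B) (\<lambda>x. 2 * (norm (f x))\<^sup>2 + 2 * (norm (g x))\<^sup>2)"
      using assms by (simp add: L2_def)
    show "(\<lambda>x. (norm (f x + g x))\<^sup>2) \<in> borel_measurable (lebesgue_on B)" using m by measurable
    show "AE x in lebesgue_on B. norm ((norm (f x + g x))\<^sup>2) \<le> norm (2 * (norm (f x))\<^sup>2 + 2 * (norm (g x))\<^sup>2)"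
    proof (rule AE_I2)
      fix x
      have "(norm (f x + g x))\<^sup>2 \<le> (norm (f x) + norm (g x))\<^sup>2"
        by (intro power_mono norm_triangle_ineq) auto
      also have "\<dots> \<le> 2 * (norm (f x))\<^sup>2 + 2 * (norm (g x))\<^sup>2"
        using zero_le_power2[of "norm (f x) - norm (g x)"] by (simp add: power2_sum power2_diff)
      finally show "norm ((norm (f x + g x))\<^sup>2) \<le> norm (2 * (norm (f x))\<^sup>2 + 2 * (norm (g x))\<^sup>2)" by simp
    qed
  qed
  then show ?thesis using m by (simp add: L2_def)
qed

lemma L2_diff:
  fixes f g :: "'a::euclidean_space \<Rightarrow> 'b::euclidean_space"
  assumes "f \<in> L2 B" "g \<in> L2 B"
  shows "(\<lambda>x. f x - g x) \<in> L2 B"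
proof -
  have "(\<lambda>x. - g x) \<in> L2 B"
    using assms(2) by (intro L2_dominated[OF assms(2), where K=1]) (auto simp: L2_def)
  from L2_add[OF assms(1) this] show ?thesis by simp
qed

lemma L2_norm:
  fixes f :: "'a::euclidean_space \<Rightarrow> 'b::euclidean_space"
  assumes "f \<in> L2 B"
  shows "(\<lambda>x. norm (f x)) \<in> L2 B"
  using assms by (auto simp: L2_def)

lemma L2_inner_integrable:
  fixes f g :: "'a::euclidean_space \<Rightarrow> 'b::euclidean_space"
  assumes "f \<in> L2 B" "g \<in> L2 B"
  shows "integrable (lebesgue_on B) (\<lambda>x. f x \<bullet> g x)"
proof (rule Bochner_Integration.integrable_bound)
  show "integrable (lebesgue_on B) (\<lambda>x. (norm (f x))\<^sup>2 + (norm (g x))\<^sup>2)"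
    using assms by (simp add: L2_def)
  show "(\<lambda>x. f x \<bullet> g x) \<in> borel_measurable (lebesgue_on B)"
    using assms by (auto simp: L2_def)
  show "AE x in lebesgue_on B. norm (f x \<bullet> g x) \<le> norm ((norm (f x))\<^sup>2 + (norm (g x))\<^sup>2)"
  proof (rule AE_I2)
    fix x
    have "\<bar>f x \<bullet> g x\<bar> \<le> norm (f x) * norm (g x)" by (rule Cauchy_Schwarz_ineq2)
    also have "\<dots> \<le> (norm (f x))\<^sup>2 + (norm (g x))\<^sup>2"
      using sum_squares_bound[of "norm (f x)" "norm (g x)"] 
        mult_nonneg_nonneg[OF norm_ge_zero[of "f x"] norm_ge_zero[of "g x"]] by linarith
    finally show "norm (f x \<bullet> g x) \<le> norm ((norm (f x))\<^sup>2 + (norm (g x))\<^sup>2)" by simp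
  qed
qed

lemma L2_const:
  fixes B :: "'a::euclidean_space set" and c :: "'b::euclidean_space"
  assumes "open B" "bounded B"
  shows "(\<lambda>x. c) \<in> L2 B"
proof -
  interpret finite_measure "lebesgue_on B"
    using assms by (intro finite_measure_lebesgue_on bounded_set_imp_lmeasurable) (auto simp: sets_completionI_sets)
  show ?thesis by (simp add: L2_def)
qed

lemma L2_imp_integrable:
  fixes f :: "'a::euclidean_space \<Rightarrow> 'b::euclidean_space"
  assumes "open B" "bounded B" "f \<in> L2 B"
  shows "integrable (lebesgue_on B) f"
proof -
  have "integrable (lebesgue_on B) (\<lambda>x. norm (f x) \<bullet> (1::real))"
    by (rule L2_inner_integrable[OF L2_norm[OF assms(3)] L2_const[OF assms(1,2)]])
  then have "integrable (lebesgue_on B) (\<lambda>x. norm (f x))" by simp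
  moreover have "f \<in> borel_measurable (lebesgue_on B)" using assms(3) by (simp add: L2_def)
  ultimately show ?thesis by (simp add: integrable_norm_iff)
qed

lemma L2_imp_locally_integrable:
  fixes f :: "'a::euclidean_space \<Rightarrow> 'b::euclidean_space"
  assumes "open B" "bounded B" "f \<in> L2 B"
  shows "locally_integrable B f"
  unfolding locally_integrable_def
proof (intro allI impI)
  fix K assume K: "compact K \<and> K \<subseteq> B"
  then have Ks: "K \<in> sets lebesgue" by (simp add: sets_completionI_sets borel_compact)
  have "B \<in> sets lebesgue" using assms(1) by (simp add: sets_completionI_sets)
  then have "integrable lebesgue (\<lambda>x. indicator B x *\<^sub>R f x)"
    using L2_imp_integrable[OF assms] by (simp add: integrable_restrict_space)
  with Ks have "integrable lebesgue (\<lambda>x. indicator K x *\<^sub>R (indicator B x *\<^sub>R f x))"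
    by (rule integrable_mult_indicator)
  moreover have "(\<lambda>x. indicator K x *\<^sub>R (indicator B x *\<^sub>R f x)) = (\<lambda>x. indicator K x *\<^sub>R f x)"
    using K by (auto simp: indicator_def fun_eq_iff)
  ultimately show "integrable (lebesgue_on K) f"
    using Ks by (simp add: integrable_restrict_space)
qed

text \<open>Cauchy-Schwarz against the constant 1, obtained by expanding the nonnegative variance
  about the mean \<open>I / \<mu>\<close>; it passes from square integral convergence to convergence
  of integrals.\<close>

lemma integral_square_le:
  fixes s :: "'a::euclidean_space \<Rightarrow> real"
  assumes "open B" "bounded B" "B \<noteq> {}" "s \<in> L2 B"
  shows "(LINT x|lebesgue_on B. s x)\<^sup>2 \<le> measure lebesgue B * (LINT x|lebesgue_on B. (s x)\<^sup>2)"
proof -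
  have Bm: "B \<in> lmeasurable"
    using assms by (intro bounded_set_imp_lmeasurable) (auto simp: sets_completionI_sets)
  interpret finite_measure "lebesgue_on B" using Bm by (rule finite_measure_lebesgue_on)
  define \<mu> where "\<mu> = measure lebesgue B"
  have \<mu>: "measure (lebesgue_on B) (space (lebesgue_on B)) = \<mu>"
    using fmeasurableD[OF Bm] by (simp add: \<mu>_def measure_restrict_space)
  have "\<mu> \<noteq> 0"
    using open_not_negligible[OF assms(1,3)] Bm negligible_iff_measure[of B] by (simp add: \<mu>_def)
  then have "\<mu> > 0" by (simp add: \<mu>_def zero_less_measure_iff)
  define I J where "I = (LINT x|lebesgue_on B. s x)" and "J = (LINT x|lebesgue_on B. (s x)\<^sup>2)"
  have s: "integrable (lebesgue_on B) s" "integrable (lebesgue_on B) (\<lambda>x. (s x)\<^sup>2)"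
    using L2_imp_integrable[OF assms(1,2,4)] assms(4) by (auto simp: L2_def)
  have "0 \<le> (LINT x|lebesgue_on B. (s x - I / \<mu>)\<^sup>2)" by (rule integral_nonneg_AE) simp
  also have "\<dots> = (LINT x|lebesgue_on B. (s x)\<^sup>2 - 2 * (I / \<mu>) * s x + (I / \<mu>)\<^sup>2)"
    by (intro Bochner_Integration.integral_cong) (auto simp: power2_diff mult_ac)
  also have "\<dots> = J - 2 * (I / \<mu>) * I + \<mu> * (I / \<mu>)\<^sup>2"
    using s \<mu> by (simp add: I_def J_def)
  finally have "0 \<le> J - I\<^sup>2 / \<mu>" using \<open>\<mu> > 0\<close> by (simp add: power2_eq_square)
  then show ?thesis using \<open>\<mu> > 0\<close> by (simp add: I_def J_def \<mu>_def[symmetric] field_simps)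
qed

section \<open>The space of test functions in \<open>H1\<close>\<close>

lemma test_function_L2:
  fixes B :: "'a::euclidean_space set"
  assumes "open B" "\<psi> \<in> test_functions B"
  shows "\<psi> \<in> L2 B" "gradient \<psi> \<in> L2 B"
proof -
  obtain K where K: "compact K" "K \<subseteq> B" "\<And>x. x \<notin> K \<Longrightarrow> \<psi> x = 0" "\<And>x. x \<notin> K \<Longrightarrow> gradient \<psi> x = 0"
    using test_functionE[OF assms(2)] by metis
  have B: "B \<in> sets lebesgue" using assms(1) by (simp add: sets_completionI_sets)
  have L2: "h \<in> L2 B" if "continuous_on UNIV h" "\<And>x. x \<notin> K \<Longrightarrow> h x = 0" for h :: "'a \<Rightarrow> 'b::euclidean_space"
  proof -
    have "integrable lebesgue (\<lambda>x. (norm (h x))\<^sup>2)"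
      by (rule integrable_continuous_supported[OF _ K(1)]) (use that in \<open>auto intro!: continuous_intros\<close>)
    moreover have "(norm (h x))\<^sup>2 = 0" if "x \<notin> B" for x
    proof -
      have "x \<notin> K" using that K(2) by (rule contra_subsetD[rotated])
      then show ?thesis using \<open>\<And>x. x \<notin> K \<Longrightarrow> h x = 0\<close> by simp
    qed
    ultimately have "integrable (lebesgue_on B) (\<lambda>x. (norm (h x))\<^sup>2)"
      by (subst integrable_lebesgue_on_supported[OF B]) auto
    moreover have "h \<in> borel_measurable (lebesgue_on B)"
      using measurable_lebesgue_continuous[OF that(1)] by (rule measurable_restrict_space1)
    ultimately show ?thesis by (simp add: L2_def)
  qed
  show "\<psi> \<in> L2 B"
    by (rule L2) (use K(3) smoothD(2)[OF test_functionsD(1)[OF assms(2)]] in auto)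
  show "gradient \<psi> \<in> L2 B"
    by (rule L2) (use K(4) smoothD(3)[OF test_functionsD(1)[OF assms(2)]] in auto)
qed

text \<open>A test function is Lipschitz and its difference quotients converge everywhere, so the
  discrete integration by parts applies to it as well.\<close>

lemma test_function_has_weak_gradient:
  fixes B :: "'a::euclidean_space set"
  assumes "open B" "\<psi> \<in> test_functions B"
  shows "has_weak_gradient B \<psi> (gradient \<psi>)"
proof -
  obtain L where L: "\<And>x y. \<bar>\<psi> x - \<psi> y\<bar> \<le> L * norm (x - y)"
    using test_function_Lipschitz[OF assms(2)] by metis
  show ?thesis
  proof (rule has_weak_gradient_Lipschitz(2)[OF assms(1) L])
    show "gradient \<psi> \<in> borel_measurable lebesgue"
      using smoothD(3)[OF test_functionsD(1)[OF assms(2)]] by (rule measurable_lebesgue_continuous)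
    show "AE x in lebesgue. (\<lambda>k. real (Suc k) * (\<psi> (x + inverse (real (Suc k)) *\<^sub>R b) - \<psi> x)) \<longlonglongrightarrow> gradient \<psi> x \<bullet> b" for b
      by (intro AE_I2 difference_quotient_tendsto smoothD(1) test_functionsD(1)[OF assms(2)])
  qed
qed

lemma test_function_H10:
  fixes B :: "'a::euclidean_space set"
  assumes "open B" "\<psi> \<in> test_functions B"
  shows "\<psi> \<in> H10 B"
proof -
  have B: "B \<in> sets lebesgue" using assms(1) by (simp add: sets_completionI_sets)
  have "(LINT x|lebesgue_on B. (\<psi> x - \<psi> x)\<^sup>2 + (norm (weak_grad B \<psi> x - gradient \<psi> x))\<^sup>2) = (LINT x|lebesgue_on B. 0)"
  proof (rule integral_lebesgue_on_cong_AE[OF B])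
    show "AE x in lebesgue_on B. (\<psi> x - \<psi> x)\<^sup>2 + (norm (weak_grad B \<psi> x - gradient \<psi> x))\<^sup>2 = 0"
      using weak_grad_AE_eq[OF assms(1) test_function_has_weak_gradient[OF assms]]
      by eventually_elim simp
  qed simp
  moreover have "\<psi> \<in> H1 B"
    using test_function_L2[OF assms] test_function_has_weak_gradient[OF assms] unfolding H1_def by blast
  ultimately show ?thesis
    unfolding H10_def using assms(2) by (auto intro!: exI[of _ "\<lambda>k. \<psi>"])
qed

lemma H10_D:
  fixes B :: "'a::euclidean_space set"
  assumes "open B" "u \<in> H10 B"
  obtains g where "u \<in> L2 B" "g \<in> L2 B" "has_weak_gradient B u g"
proof -
  have "u \<in> H1 B" using assms(2) by (simp add: H10_def)
  then have "u \<in> L2 B \<and> (\<exists>g\<in>L2 B. has_weak_gradient B u g)" by (simp add: H1_def)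
  then show thesis using that by (elim conjE bexE)
qed

lemma L2_square_integrable: "f \<in> L2 B \<Longrightarrow> integrable (lebesgue_on B) (\<lambda>x. (f x)\<^sup>2)" for f :: "'a::euclidean_space \<Rightarrow> real"
  by (simp add: L2_def)

text \<open>Approximation in the L1 sense suffices for the product rule, where the differences are
  multiplied only by bounded functions; on the bounded set \<open>B\<close> it follows from the
  square integral convergence in \<open>H10\<close>. The chosen \<open>weak_grad\<close> is traded
  for the given \<open>g\<close>.\<close>

lemma H10_approx:
  fixes B :: "'a::euclidean_space set"
  assumes "open B" "bounded B" "B \<noteq> {}" "u \<in> H10 B" "g \<in> L2 B" "has_weak_gradient B u g"
  shows "\<exists>\<psi>. (\<forall>k. \<psi> k \<in> test_functions B) \<and>
    (\<lambda>k. LINT x|lebesgue_on B. \<bar>u x - \<psi> k x\<bar> + norm (g x - gradient (\<psi> k) x)) \<longlonglongrightarrow> 0"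
proof -
  have B: "B \<in> sets lebesgue" using assms(1) by (simp add: sets_completionI_sets)
  have u: "u \<in> L2 B" using assms(4) by (simp add: H10_def H1_def)
  obtain \<psi> where \<psi>: "\<And>k::nat. \<psi> k \<in> test_functions B"
    and lim: "(\<lambda>k. LINT x|lebesgue_on B. (u x - \<psi> k x)\<^sup>2 + (norm (weak_grad B u x - gradient (\<psi> k) x))\<^sup>2) \<longlonglongrightarrow> 0"
  proof -
    have "\<exists>\<psi>. (\<forall>k::nat. \<psi> k \<in> test_functions B) \<and>
        (\<lambda>k. LINT x|lebesgue_on B. (u x - \<psi> k x)\<^sup>2 + (norm (weak_grad B u x - gradient (\<psi> k) x))\<^sup>2) \<longlonglongrightarrow> 0"
      using assms(4) by (simp only: H10_def mem_Collect_eq)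
    then obtain \<psi> where c: "(\<forall>k::nat. \<psi> k \<in> test_functions B) \<and>
        (\<lambda>k. LINT x|lebesgue_on B. (u x - \<psi> k x)\<^sup>2 + (norm (weak_grad B u x - gradient (\<psi> k) x))\<^sup>2) \<longlonglongrightarrow> 0" ..
    have "\<psi> k \<in> test_functions B" for k using conjunct1[OF c] by (rule spec)
    then show thesis using conjunct2[OF c] by (rule that[of \<psi>])
  qed
  let ?E = "\<lambda>k x. (u x - \<psi> k x)\<^sup>2 + (norm (g x - gradient (\<psi> k) x))\<^sup>2"
  let ?s = "\<lambda>k x. \<bar>u x - \<psi> k x\<bar> + norm (g x - gradient (\<psi> k) x)"
  have du: "(\<lambda>x. u x - \<psi> k x) \<in> L2 B" for k using u test_function_L2(1)[OF assms(1) \<psi>] by (rule L2_diff)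
  have dg: "(\<lambda>x. g x - gradient (\<psi> k) x) \<in> L2 B" for k
    using assms(5) test_function_L2(2)[OF assms(1) \<psi>] by (rule L2_diff)
  have Ei: "integrable (lebesgue_on B) (?E k)" for k
    using du[of k] dg[of k] by (simp add: L2_def)
  have sL2: "?s k \<in> L2 B" for k
    using L2_add[OF L2_norm[OF du] L2_norm[OF dg], of k k] by simp
  have Eq: "(LINT x|lebesgue_on B. (u x - \<psi> k x)\<^sup>2 + (norm (weak_grad B u x - gradient (\<psi> k) x))\<^sup>2)
      = (LINT x|lebesgue_on B. ?E k x)" for k
  proof (rule integral_lebesgue_on_cong_AE[OF B])
    show "?E k \<in> borel_measurable (lebesgue_on B)" using Ei[of k] by (rule borel_measurable_integrable)
    show "AE x in lebesgue_on B. (u x - \<psi> k x)\<^sup>2 + (norm (weak_grad B u x - gradient (\<psi> k) x))\<^sup>2 = ?E k x"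
      using weak_grad_AE_eq[OF assms(1,6)] by eventually_elim simp
  qed
  \<comment> \<open>The factor 2 is that of (a + b)^2 \<le> 2 (a^2 + b^2); the measure of
    \<open>B\<close> comes from Cauchy-Schwarz.\<close>
  have bound: "\<bar>LINT x|lebesgue_on B. ?s k x\<bar> \<le> sqrt (measure lebesgue B * (2 * (LINT x|lebesgue_on B. ?E k x)))" for k
  proof (rule real_le_rsqrt)
    have "(LINT x|lebesgue_on B. (?s k x)\<^sup>2) \<le> (LINT x|lebesgue_on B. 2 * ?E k x)"
    proof (rule integral_mono_AE)
      show "integrable (lebesgue_on B) (\<lambda>x. (?s k x)\<^sup>2)" by (rule L2_square_integrable[OF sL2])
      show "integrable (lebesgue_on B) (\<lambda>x. 2 * ?E k x)" using Ei[of k] by (rule integrable_mult_right)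
      have "(a + b)\<^sup>2 \<le> 2 * (a\<^sup>2 + b\<^sup>2)" for a b :: real
        using zero_le_power2[of "a - b"] by (simp add: power2_sum power2_diff)
      then have "(?s k x)\<^sup>2 \<le> 2 * (\<bar>u x - \<psi> k x\<bar>\<^sup>2 + (norm (g x - gradient (\<psi> k) x))\<^sup>2)" for x .
      then show "AE x in lebesgue_on B. (?s k x)\<^sup>2 \<le> 2 * ?E k x"
        unfolding power2_abs by (rule AE_I2)
    qed
    then have "measure lebesgue B * (LINT x|lebesgue_on B. (?s k x)\<^sup>2) \<le> measure lebesgue B * (2 * (LINT x|lebesgue_on B. ?E k x))"
      unfolding integral_mult_right_zero by (intro mult_left_mono measure_nonneg)
    with integral_square_le[OF assms(1-3) sL2[of k]]
    show "\<bar>LINT x|lebesgue_on B. ?s k x\<bar>\<^sup>2 \<le> measure lebesgue B * (2 * (LINT x|lebesgue_on B. ?E k x))"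
      unfolding power2_abs by (rule order_trans)
  qed
  define E where "E = (\<lambda>k. LINT x|lebesgue_on B. ?E k x)"
  define S where "S = (\<lambda>k. LINT x|lebesgue_on B. ?s k x)"
  have "E \<longlonglongrightarrow> 0" using lim unfolding Eq E_def .
  then have "(\<lambda>k. sqrt (measure lebesgue B * (2 * E k))) \<longlonglongrightarrow> sqrt (measure lebesgue B * (2 * 0))"
    by (intro tendsto_intros)
  then have "(\<lambda>k. sqrt (measure lebesgue B * (2 * E k))) \<longlonglongrightarrow> 0" by simp
  moreover have "\<forall>\<^sub>F k in sequentially. norm (S k) \<le> sqrt (measure lebesgue B * (2 * E k))"
    using bound unfolding E_def S_def real_norm_def by (intro always_eventually allI)
  ultimately have "S \<longlonglongrightarrow> 0" by (rule Lim_null_comparison[rotated])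
  moreover have "\<forall>k. \<psi> k \<in> test_functions B" using \<psi> by (rule allI)
  ultimately show ?thesis unfolding S_def by (intro exI[of _ \<psi>] conjI)
qed

section \<open>Coercivity and asymmetry\<close>

text \<open>All that coercivity and asymmetry take from the geometry: a continuous
  \<open>\<phi>\<close> with values strictly between 0 and 1 and a bounded explicit representative
  \<open>p\<close> of its weak gradient.\<close>

locale phase_field_form =
  fixes B :: "'a::euclidean_space set" and \<phi> :: "'a \<Rightarrow> real" and p :: "'a \<Rightarrow> 'a" and D :: "'a \<Rightarrow> real"
    and \<epsilon> P K d :: real
  assumes B: "open B" "bounded B" "B \<noteq> {}"
    and \<phi>: "continuous_on UNIV \<phi>" "\<And>x. 0 < \<phi> x" "\<And>x. \<phi> x < 1"
    and p: "p \<in> borel_measurable lebesgue" "has_weak_gradient B \<phi> p" "AE x in lebesgue. norm (p x) \<le> P"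
    and D: "D \<in> borel_measurable (lebesgue_on B)" "\<And>x. x \<in> B \<Longrightarrow> \<bar>D x\<bar> \<le> K" "\<And>x. x \<in> B \<Longrightarrow> d \<le> D x"
    and d: "d > 0"
begin

lemma B_sets: "B \<in> sets lebesgue" using B(1) by (simp add: sets_completionI_sets)

lemma measurable_\<phi>: "\<phi> \<in> borel_measurable (lebesgue_on B)"
  using measurable_lebesgue_continuous[OF \<phi>(1)] by (rule measurable_restrict_space1)

lemma measurable_p: "p \<in> borel_measurable (lebesgue_on B)"
  using p(1) by (rule measurable_restrict_space1)

lemma AE_p: "AE x in lebesgue_on B. norm (p x) \<le> P"
proof -
  have "AE x in lebesgue. x \<in> B \<longrightarrow> norm (p x) \<le> P" using p(3) by eventually_elim simp
  then show ?thesis using B_sets by (simp add: AE_restrict_space_iff)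
qed

lemma AE_D: "AE x in lebesgue_on B. \<bar>D x\<bar> \<le> K"
  by (rule AE_I2) (simp add: D(2))

lemma L2_\<phi>: "f \<in> L2 B \<Longrightarrow> (\<lambda>x. \<phi> x *\<^sub>R f x) \<in> L2 B" for f :: "'a \<Rightarrow> 'b::euclidean_space"
proof (rule L2_dominated[where K=1 and f=f])
  assume f: "f \<in> L2 B"
  then show "(\<lambda>x. \<phi> x *\<^sub>R f x) \<in> borel_measurable (lebesgue_on B)"
    by (intro borel_measurable_scaleR measurable_\<phi>) (simp add: L2_def)
  have "norm (\<phi> x *\<^sub>R f x) \<le> 1 * norm (f x)" for x
    using \<phi>(2,3)[of x] unfolding norm_scaleR by (intro mult_right_mono) auto
  then show "AE x in lebesgue_on B. norm (\<phi> x *\<^sub>R f x) \<le> 1 * norm (f x)" by (rule AE_I2)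
qed

lemma L2_p: "u \<in> L2 B \<Longrightarrow> (\<lambda>x. u x *\<^sub>R p x) \<in> L2 B" for u :: "'a \<Rightarrow> real"
proof (rule L2_dominated[where K=P and f=u])
  assume u: "u \<in> L2 B"
  then show "(\<lambda>x. u x *\<^sub>R p x) \<in> borel_measurable (lebesgue_on B)"
    by (intro borel_measurable_scaleR measurable_p) (simp add: L2_def)
  show "AE x in lebesgue_on B. norm (u x *\<^sub>R p x) \<le> P * norm (u x)"
    using AE_p
  proof eventually_elim
    case (elim x)
    then have "\<bar>u x\<bar> * norm (p x) \<le> \<bar>u x\<bar> * P" by (intro mult_left_mono) auto
    then show ?case by (simp add: mult.commute)
  qed
qed

text \<open>
  For a test function \<open>\<psi>\<close> the product rule is the definition of the weak gradient of \<open>\<phi>\<close>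
  tested with \<open>\<psi> \<eta>\<close>; both sides are continuous along a sequence of test functions approximating \<open>u\<close>.
\<close>

lemma has_weak_gradient_product:
  assumes "u \<in> H10 B" "g \<in> L2 B" "has_weak_gradient B u g"
  shows "has_weak_gradient B (\<lambda>x. \<phi> x * u x) (\<lambda>x. \<phi> x *\<^sub>R g x + u x *\<^sub>R p x)"
    and "(\<lambda>x. \<phi> x *\<^sub>R g x + u x *\<^sub>R p x) \<in> L2 B"
proof -
  have u: "u \<in> L2 B" using assms(1) by (simp add: H10_def H1_def)
  show w: "(\<lambda>x. \<phi> x *\<^sub>R g x + u x *\<^sub>R p x) \<in> L2 B"
    by (intro L2_add L2_\<phi> L2_p assms(2) u)
  have \<phi>u: "(\<lambda>x. \<phi> x * u x) \<in> L2 B" using L2_\<phi>[OF u] by simp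
  note loc = L2_imp_locally_integrable[OF B(1,2) \<phi>u] L2_imp_locally_integrable[OF B(1,2) w]
  obtain \<psi> where approx: "(\<forall>k. \<psi> k \<in> test_functions B) \<and>
      (\<lambda>k. LINT x|lebesgue_on B. \<bar>u x - \<psi> k x\<bar> + norm (g x - gradient (\<psi> k) x)) \<longlonglongrightarrow> 0"
    using H10_approx[OF B assms] ..
  have \<psi>: "\<psi> k \<in> test_functions B" for k using conjunct1[OF approx] by (rule spec)
  note lim = conjunct2[OF approx]
  have "(LINT x|lebesgue_on B. (\<phi> x * u x) *\<^sub>R gradient \<eta> x) = - (LINT x|lebesgue_on B. \<eta> x *\<^sub>R (\<phi> x *\<^sub>R g x + u x *\<^sub>R p x))"
    if \<eta>: "\<eta> \<in> test_functions B" for \<eta>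
  proof -
    obtain M where M: "M > 0" "\<And>x. \<bar>\<eta> x\<bar> \<le> M" "\<And>x. norm (gradient \<eta> x) \<le> M"
      using test_function_bounded[OF \<eta>] by metis
    \<comment> \<open>The integral of \<open>T v h\<close> vanishes exactly when the weak gradient
      identity for \<open>\<phi> v\<close> holds against \<open>\<eta>\<close>, with
      \<open>h\<close> in the role of \<open>\<nabla>v\<close>; \<open>T\<close> is linear in the
      pair \<open>v\<close>, \<open>h\<close>.\<close>
    define T where "T = (\<lambda>v h x. (\<phi> x * v x) *\<^sub>R gradient \<eta> x + \<eta> x *\<^sub>R (\<phi> x *\<^sub>R h x + v x *\<^sub>R p x))"
    have \<eta>m: "\<eta> \<in> borel_measurable (lebesgue_on B)" "gradient \<eta> \<in> borel_measurable (lebesgue_on B)"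
      using test_function_L2[OF B(1) \<eta>] by (auto simp: L2_def)
    have int1: "integrable (lebesgue_on B) (\<lambda>x. (\<phi> x * v x) *\<^sub>R gradient \<eta> x)" if v: "v \<in> L2 B" for v
    proof (rule L2_imp_integrable[OF B(1,2)], rule L2_dominated[where K=M and f="\<lambda>x. \<phi> x * v x"])
      show "(\<lambda>x. \<phi> x * v x) \<in> L2 B" using L2_\<phi>[OF v] by simp
      then show "(\<lambda>x. (\<phi> x * v x) *\<^sub>R gradient \<eta> x) \<in> borel_measurable (lebesgue_on B)"
        by (intro borel_measurable_scaleR \<eta>m(2)) (simp add: L2_def)
      have "norm ((\<phi> x * v x) *\<^sub>R gradient \<eta> x) \<le> M * norm (\<phi> x * v x)" for x
        using mult_left_mono[OF M(3)[of x], of "norm (\<phi> x * v x)"] unfolding norm_scaleR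
        by (simp add: mult.commute)
      then show "AE x in lebesgue_on B. norm ((\<phi> x * v x) *\<^sub>R gradient \<eta> x) \<le> M * norm (\<phi> x * v x)"
        by (rule AE_I2)
    qed
    have int2: "integrable (lebesgue_on B) (\<lambda>x. \<eta> x *\<^sub>R (\<phi> x *\<^sub>R h x + v x *\<^sub>R p x))"
      if "v \<in> L2 B" "h \<in> L2 B" for v h
      using that by (intro integrable_test_scaleR[OF B(1) \<eta>] L2_imp_locally_integrable[OF B(1,2)] L2_add L2_\<phi> L2_p)
    have intT: "integrable (lebesgue_on B) (T v h)" if "v \<in> L2 B" "h \<in> L2 B" for v h
      unfolding T_def using int1 int2 that by (intro Bochner_Integration.integrable_add)
    have T0: "(LINT x|lebesgue_on B. T (\<psi> k) (gradient (\<psi> k)) x) = 0" for k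
    proof -
      have \<psi>\<eta>: "(\<lambda>x. \<psi> k x * \<eta> x) \<in> test_functions B"
        using \<psi> \<eta> by (intro test_function_mult test_functionsD(1))
      have "T (\<psi> k) (gradient (\<psi> k)) x = \<phi> x *\<^sub>R gradient (\<lambda>x. \<psi> k x * \<eta> x) x + (\<psi> k x * \<eta> x) *\<^sub>R p x" for x
        using \<psi> \<eta> by (subst gradient_mult) (auto simp: T_def algebra_simps intro!: smoothD(1) dest: test_functionsD(1))
      then have "(LINT x|lebesgue_on B. T (\<psi> k) (gradient (\<psi> k)) x)
          = (LINT x|lebesgue_on B. \<phi> x *\<^sub>R gradient (\<lambda>x. \<psi> k x * \<eta> x) x + (\<psi> k x * \<eta> x) *\<^sub>R p x)"
        by (simp only:)
      also have "\<dots> = (LINT x|lebesgue_on B. \<phi> x *\<^sub>R gradient (\<lambda>x. \<psi> k x * \<eta> x) x) + (LINT x|lebesgue_on B. (\<psi> k x * \<eta> x) *\<^sub>R p x)"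
      proof (rule Bochner_Integration.integral_add)
        show "integrable (lebesgue_on B) (\<lambda>x. \<phi> x *\<^sub>R gradient (\<lambda>x. \<psi> k x * \<eta> x) x)"
          by (intro L2_imp_integrable[OF B(1,2)] L2_\<phi> test_function_L2(2)[OF B(1) \<psi>\<eta>])
        show "integrable (lebesgue_on B) (\<lambda>x. (\<psi> k x * \<eta> x) *\<^sub>R p x)"
          by (intro L2_imp_integrable[OF B(1,2)] L2_p test_function_L2(1)[OF B(1) \<psi>\<eta>])
      qed
      also have "\<dots> = 0"
        using p(2) \<psi>\<eta> unfolding has_weak_gradient_def by simp
      finally show ?thesis .
    qed
    \<comment> \<open>The constant collects \<open>\<bar>\<phi>\<bar> \<le> 1\<close>, the bound
      \<open>M\<close> for \<open>\<eta>\<close> and its gradient, and \<open>P\<close> for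
      \<open>p\<close>: the three terms are at most \<open>M * \<bar>a\<bar>\<close>,
      \<open>M * norm e\<close> and \<open>M * P * \<bar>a\<bar>\<close>.\<close>
    have "norm (LINT x|lebesgue_on B. T u g x) \<le> (2 * M + M * P) * (LINT x|lebesgue_on B. \<bar>u x - \<psi> k x\<bar> + norm (g x - gradient (\<psi> k) x))" for k
    proof -
      have \<psi>2: "\<psi> k \<in> L2 B" "gradient (\<psi> k) \<in> L2 B" using test_function_L2[OF B(1) \<psi>] by auto
      have i: "integrable (lebesgue_on B) (\<lambda>x. \<bar>u x - \<psi> k x\<bar> + norm (g x - gradient (\<psi> k) x))"
        using L2_imp_integrable[OF B(1,2) L2_diff[OF u \<psi>2(1)]] L2_imp_integrable[OF B(1,2) L2_diff[OF assms(2) \<psi>2(2)]]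
        by (intro Bochner_Integration.integrable_add integrable_abs integrable_norm)
      have "(LINT x|lebesgue_on B. T u g x) = (LINT x|lebesgue_on B. T u g x - T (\<psi> k) (gradient (\<psi> k)) x)"
        using intT[OF u assms(2)] intT[OF \<psi>2] by (simp add: T0)
      also have "norm \<dots> \<le> (LINT x|lebesgue_on B. norm (T u g x - T (\<psi> k) (gradient (\<psi> k)) x))"
        by (rule integral_norm_bound)
      also have "\<dots> \<le> (LINT x|lebesgue_on B. (2 * M + M * P) * (\<bar>u x - \<psi> k x\<bar> + norm (g x - gradient (\<psi> k) x)))"
      proof (rule integral_mono_AE)
        show "integrable (lebesgue_on B) (\<lambda>x. norm (T u g x - T (\<psi> k) (gradient (\<psi> k)) x))"
          by (intro integrable_norm Bochner_Integration.integrable_diff intT u assms(2) \<psi>2)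
        show "integrable (lebesgue_on B) (\<lambda>x. (2 * M + M * P) * (\<bar>u x - \<psi> k x\<bar> + norm (g x - gradient (\<psi> k) x)))"
          using i by (rule integrable_mult_right)
        show "AE x in lebesgue_on B. norm (T u g x - T (\<psi> k) (gradient (\<psi> k)) x) \<le> (2 * M + M * P) * (\<bar>u x - \<psi> k x\<bar> + norm (g x - gradient (\<psi> k) x))"
          using AE_p
        proof eventually_elim
          case (elim x)
          define a e where "a = u x - \<psi> k x" and "e = g x - gradient (\<psi> k) x"
          \<comment> \<open>The sign of \<open>P\<close> is read off from the bound on
            \<open>norm (p x)\<close> at the point at hand.\<close>
          have P0: "0 \<le> P" using elim norm_ge_zero[of "p x"] by linarith
          have \<phi>1: "\<bar>\<phi> x\<bar> \<le> 1" using \<phi>(2,3)[of x] by simp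
          have "T u g x - T (\<psi> k) (gradient (\<psi> k)) x = (\<phi> x * a) *\<^sub>R gradient \<eta> x + (\<eta> x * \<phi> x) *\<^sub>R e + (\<eta> x * a) *\<^sub>R p x"
            by (simp add: T_def a_def e_def algebra_simps)
          then have "norm (T u g x - T (\<psi> k) (gradient (\<psi> k)) x) = norm ((\<phi> x * a) *\<^sub>R gradient \<eta> x + (\<eta> x * \<phi> x) *\<^sub>R e + (\<eta> x * a) *\<^sub>R p x)"
            by (rule arg_cong)
          also have "\<dots> \<le> norm ((\<phi> x * a) *\<^sub>R gradient \<eta> x) + norm ((\<eta> x * \<phi> x) *\<^sub>R e) + norm ((\<eta> x * a) *\<^sub>R p x)"
            by (rule order_trans[OF norm_triangle_ineq add_right_mono[OF norm_triangle_ineq]])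
          also have "norm ((\<phi> x * a) *\<^sub>R gradient \<eta> x) \<le> (1 * \<bar>a\<bar>) * M"
            unfolding norm_scaleR abs_mult by (intro mult_mono \<phi>1 M(3)) auto
          also have "norm ((\<eta> x * \<phi> x) *\<^sub>R e) \<le> (M * 1) * norm e"
            unfolding norm_scaleR abs_mult using M(1) by (intro mult_mono \<phi>1 M(2)) auto
          also have "norm ((\<eta> x * a) *\<^sub>R p x) \<le> (M * \<bar>a\<bar>) * P"
            unfolding norm_scaleR abs_mult using M(1) elim by (intro mult_mono M(2)) auto
          also have "1 * \<bar>a\<bar> * M + M * 1 * norm e + M * \<bar>a\<bar> * P \<le> (2 * M + M * P) * (\<bar>a\<bar> + norm e)"
          proof -
            have "0 \<le> M * \<bar>a\<bar> + M * norm e + M * P * norm e" using M(1) P0 by simp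
            then show ?thesis by (simp add: algebra_simps)
          qed
          finally show ?case by (simp add: a_def e_def)
        qed
      qed
      finally show ?thesis by simp
    qed
    then have "norm (LINT x|lebesgue_on B. T u g x) \<le> (2 * M + M * P) * 0"
      by (intro LIMSEQ_le_const[OF tendsto_mult_left[OF lim]]) auto
    then have "(LINT x|lebesgue_on B. T u g x) = 0" by simp
    then have "(LINT x|lebesgue_on B. (\<phi> x * u x) *\<^sub>R gradient \<eta> x) + (LINT x|lebesgue_on B. \<eta> x *\<^sub>R (\<phi> x *\<^sub>R g x + u x *\<^sub>R p x)) = 0"
      unfolding T_def by (subst (asm) Bochner_Integration.integral_add[OF int1[OF u] int2[OF u assms(2)]])
    then show ?thesis by (rule eq_neg_iff_add_eq_0[THEN iffD2])
  qed
  then show "has_weak_gradient B (\<lambda>x. \<phi> x * u x) (\<lambda>x. \<phi> x *\<^sub>R g x + u x *\<^sub>R p x)"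
    using loc by (simp add: has_weak_gradient_def)
qed

text \<open>Arranged so that every term is \<open>D\<close> times an inner product of two square integrable functions.\<close>

definition integrand :: "('a \<Rightarrow> real) \<Rightarrow> ('a \<Rightarrow> 'a) \<Rightarrow> ('a \<Rightarrow> real) \<Rightarrow> ('a \<Rightarrow> 'a) \<Rightarrow> 'a \<Rightarrow> real" where
  "integrand u g v h x =
     D x * ((\<phi> x *\<^sub>R g x) \<bullet> (\<phi> x *\<^sub>R h x + v x *\<^sub>R p x) + (v x *\<^sub>R p x) \<bullet> (\<phi> x *\<^sub>R g x + u x *\<^sub>R p x)
       + (\<phi> x *\<^sub>R u x - u x) \<bullet> (- inverse (\<epsilon>\<^sup>2) * v x))"

lemma integrable_D: "integrable (lebesgue_on B) f \<Longrightarrow> integrable (lebesgue_on B) (\<lambda>x. D x * f x)" for f :: "'a \<Rightarrow> real"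
proof (rule Bochner_Integration.integrable_bound)
  assume f: "integrable (lebesgue_on B) f"
  then show "integrable (lebesgue_on B) (\<lambda>x. K * f x)" by (rule integrable_mult_right)
  show "(\<lambda>x. D x * f x) \<in> borel_measurable (lebesgue_on B)"
    using f by (intro borel_measurable_times D(1) borel_measurable_integrable)
  show "AE x in lebesgue_on B. norm (D x * f x) \<le> norm (K * f x)"
    using AE_D
  proof eventually_elim
    case (elim x)
    then show ?case by (auto simp: abs_mult intro!: mult_right_mono)
  qed
qed

lemma integrable_integrand:
  assumes "u \<in> L2 B" "g \<in> L2 B" "v \<in> L2 B" "h \<in> L2 B"
  shows "integrable (lebesgue_on B) (integrand u g v h)"
proof -
  have "(\<lambda>x. - inverse (\<epsilon>\<^sup>2) * v x) \<in> L2 B"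
    using assms(3) by (intro L2_dominated[OF assms(3), where K="\<bar>inverse (\<epsilon>\<^sup>2)\<bar>"]) (auto simp: L2_def abs_mult)
  then show ?thesis
    unfolding integrand_def using assms
    by (intro integrable_D Bochner_Integration.integrable_add L2_inner_integrable L2_add L2_diff L2_\<phi> L2_p)
qed

text \<open>From here on the form is an integral of explicit functions: the weak gradients of
  \<open>u\<close>, \<open>\<phi>\<close>, \<open>\<phi> u\<close> and \<open>\<phi> v\<close> are
  replaced almost everywhere. Integrability is recorded as well, for comparing and subtracting such
  integrals.\<close>

lemma dd_form_eq:
  assumes u: "u \<in> H10 B" "g \<in> L2 B" "has_weak_gradient B u g"
    and v: "v \<in> H10 B" "h \<in> L2 B" "has_weak_gradient B v h"
  shows "dd_form B \<phi> D \<epsilon> u v = (LINT x|lebesgue_on B. integrand u g v h x)"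
    and "integrable (lebesgue_on B) (integrand u g v h)"
proof -
  have L2: "u \<in> L2 B" "v \<in> L2 B" using u(1) v(1) by (auto simp: H10_def H1_def)
  show int: "integrable (lebesgue_on B) (integrand u g v h)"
    using L2 u v by (intro integrable_integrand)
  show "dd_form B \<phi> D \<epsilon> u v = (LINT x|lebesgue_on B. integrand u g v h x)"
    unfolding dd_form_def
  proof (rule integral_lebesgue_on_cong_AE[OF B_sets borel_measurable_integrable[OF int]])
    show "AE x in lebesgue_on B.
        \<phi> x * D x * (weak_grad B u x \<bullet> weak_grad B (\<lambda>y. \<phi> y * v y) x)
        + D x * (weak_grad B \<phi> x \<bullet> weak_grad B (\<lambda>y. \<phi> y * u y) x) * v x
        + D x / \<epsilon>\<^sup>2 * (1 - \<phi> x) * u x * v x = integrand u g v h x"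
      using weak_grad_AE_eq[OF B(1) u(3)] weak_grad_AE_eq[OF B(1) p(2)]
        weak_grad_AE_eq[OF B(1) has_weak_gradient_product(1)[OF u]]
        weak_grad_AE_eq[OF B(1) has_weak_gradient_product(1)[OF v]]
    proof eventually_elim
      case (elim x)
      show ?case
        unfolding elim integrand_def by (simp add: algebra_simps divide_inverse)
    qed
  qed
qed

lemma coercive:
  assumes "u \<in> H10 B"
  shows "d * dd_norm_sq B \<phi> \<epsilon> u \<le> dd_form B \<phi> D \<epsilon> u u"
proof -
  obtain g where g: "u \<in> L2 B" "g \<in> L2 B" "has_weak_gradient B u g"
    by (rule H10_D[OF B(1) assms])
  define w where "w = (\<lambda>x. \<phi> x *\<^sub>R g x + u x *\<^sub>R p x)"
  have w: "w \<in> L2 B" "has_weak_gradient B (\<lambda>x. \<phi> x * u x) w"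
    using has_weak_gradient_product[OF assms g(2,3)] by (simp_all add: w_def)
  define N where "N = (\<lambda>x. (norm (w x))\<^sup>2 + (1 - \<phi> x) * \<bar>u x\<bar>\<^sup>2 / \<epsilon>\<^sup>2)"
  have N: "integrable (lebesgue_on B) N"
  proof -
    have "integrable (lebesgue_on B) (\<lambda>x. (u x - \<phi> x *\<^sub>R u x) \<bullet> u x)"
      using g(1) by (intro L2_inner_integrable L2_diff L2_\<phi>)
    then have "integrable (lebesgue_on B) (\<lambda>x. (1 - \<phi> x) * \<bar>u x\<bar>\<^sup>2)"
      by (simp add: power2_eq_square algebra_simps)
    then show ?thesis
      unfolding N_def using w(1) by (intro Bochner_Integration.integrable_add integrable_divide) (auto simp: L2_def)
  qed
  have "dd_norm_sq B \<phi> \<epsilon> u = (LINT x|lebesgue_on B. N x)"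
    unfolding dd_norm_sq_def
  proof (rule integral_lebesgue_on_cong_AE[OF B_sets borel_measurable_integrable[OF N]])
    show "AE x in lebesgue_on B. (norm (weak_grad B (\<lambda>y. \<phi> y * u y) x))\<^sup>2 + (1 - \<phi> x) * \<bar>u x\<bar>\<^sup>2 / \<epsilon>\<^sup>2 = N x"
      using weak_grad_AE_eq[OF B(1) w(2)] by eventually_elim (simp add: N_def)
  qed
  then have "d * dd_norm_sq B \<phi> \<epsilon> u = (LINT x|lebesgue_on B. d * N x)" by simp
  also have "\<dots> \<le> (LINT x|lebesgue_on B. integrand u g u g x)"
  proof (rule integral_mono_AE)
    show "AE x in lebesgue_on B. d * N x \<le> integrand u g u g x"
    proof (rule AE_I2)
      fix x assume "x \<in> space (lebesgue_on B)"
      then have Dx: "d \<le> D x" using D(3) by simp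
      \<comment> \<open>The comparison is made pointwise: multiplying \<open>d \<le> D x\<close> by
        \<open>N x\<close> requires a nonnegative \<open>N x\<close>, which rests on
        \<open>\<phi> < 1\<close>.\<close>
      have "N x \<ge> 0" using \<phi>(3)[of x] by (simp add: N_def)
      with Dx have "d * N x \<le> D x * N x" by (rule mult_right_mono)
      also have "D x * N x = integrand u g u g x"
        unfolding N_def integrand_def power2_norm_eq_inner w_def
        by (simp add: algebra_simps power2_eq_square divide_inverse)
      finally show "d * N x \<le> integrand u g u g x" .
    qed
  qed (use N dd_form_eq(2)[OF assms g(2,3) assms g(2,3)] in auto)
  also have "\<dots> = dd_form B \<phi> D \<epsilon> u u" using dd_form_eq(1)[OF assms g(2,3) assms g(2,3)] by simp
  finally show ?thesis .
qed

text \<open>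
  The difference \<open>a(u,v) - a(v,u)\<close> is the integral of \<open>2 D \<phi> \<nabla>\<phi> \<bullet> (v \<nabla>u - u \<nabla>v)\<close>, which for
  \<open>v = x\<^sub>b u\<close> is \<open>- 2 D \<phi> u\<^sup>2 \<partial>\<^sub>b\<phi>\<close>.
\<close>

lemma AE_gradient_zero_if_symmetric:
  assumes sym: "\<forall>u\<in>H10 B. \<forall>v\<in>H10 B. dd_form B \<phi> D \<epsilon> u v = dd_form B \<phi> D \<epsilon> v u"
  shows "AE x in lebesgue_on B. p x = 0"
proof -
  \<comment> \<open>The fundamental lemma is applied to one component at a time; the positive
    factors \<open>D\<close> and \<open>\<phi>\<close> are divided out at the end.\<close>
  have "AE x in lebesgue_on B. D x * (\<phi> x * (p x \<bullet> b)) = 0" if b: "b \<in> Basis" for b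
  proof (rule AE_zero_if_test_integrals_zero[OF B(1)])
    have "(\<lambda>x. D x * (\<phi> x * (p x \<bullet> b))) \<in> L2 B"
    proof (rule L2_dominated[OF L2_const[OF B(1,2), of "1::real"], where K="K * (1 * P)"])
      show "(\<lambda>x. D x * (\<phi> x * (p x \<bullet> b))) \<in> borel_measurable (lebesgue_on B)"
        by (intro borel_measurable_times borel_measurable_inner D(1) measurable_\<phi> measurable_p borel_measurable_const)
      show "AE x in lebesgue_on B. norm (D x * (\<phi> x * (p x \<bullet> b))) \<le> K * (1 * P) * norm (1::real)"
        using AE_p AE_D
      proof eventually_elim
        case (elim x)
        have "\<bar>p x \<bullet> b\<bar> \<le> P" using elim(1) Basis_le_norm[OF b, of "p x"] by linarith
        then have "\<bar>D x\<bar> * (\<bar>\<phi> x\<bar> * \<bar>p x \<bullet> b\<bar>) \<le> K * (1 * P)"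
          using \<phi>(2,3)[of x] elim by (intro mult_mono) auto
        then show ?case by (simp add: abs_mult)
      qed
    qed
    then show "locally_integrable B (\<lambda>x. D x * (\<phi> x * (p x \<bullet> b)))"
      by (rule L2_imp_locally_integrable[OF B(1,2)])
    fix u assume u: "u \<in> test_functions B"
    define v where "v = (\<lambda>x. u x * (x \<bullet> b))"
    have v: "v \<in> test_functions B"
      unfolding v_def using u smooth_inner by (rule test_function_mult)
    have "gradient (\<lambda>x. x \<bullet> b) x = b" for x
      by (rule gradient_eqI) (auto intro!: derivative_eq_intros simp: inner_commute)
    then have grad_v: "gradient v x = u x *\<^sub>R b + (x \<bullet> b) *\<^sub>R gradient u x" for x
      unfolding v_def
      by (subst gradient_mult) (auto intro!: smoothD(1) smooth_inner test_functionsD(1)[OF u])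
    note u' = test_function_H10[OF B(1) u] test_function_L2(2)[OF B(1) u] test_function_has_weak_gradient[OF B(1) u]
    note v' = test_function_H10[OF B(1) v] test_function_L2(2)[OF B(1) v] test_function_has_weak_gradient[OF B(1) v]
    let ?uv = "integrand u (gradient u) v (gradient v)" and ?vu = "integrand v (gradient v) u (gradient u)"
    \<comment> \<open>The first two inner products in \<open>integrand\<close> contribute one mixed
      term each, hence the factor 2. In \<open>u \<nabla>v - v \<nabla>u\<close> the terms with
      \<open>\<nabla>u\<close> cancel and u^2 b remains; all other terms are symmetric.\<close>
    have diff: "?vu x - ?uv x = 2 * ((u x)\<^sup>2 *\<^sub>R (D x * (\<phi> x * (p x \<bullet> b))))" for x
      unfolding integrand_def grad_v
      by (simp add: v_def algebra_simps power2_eq_square inner_commute)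
    have "0 = dd_form B \<phi> D \<epsilon> v u - dd_form B \<phi> D \<epsilon> u v" using sym u'(1) v'(1) by simp
    also have "\<dots> = (LINT x|lebesgue_on B. ?vu x - ?uv x)"
      using dd_form_eq[OF u' v'] dd_form_eq[OF v' u'] by simp
    also have "\<dots> = 2 * (LINT x|lebesgue_on B. (u x)\<^sup>2 *\<^sub>R (D x * (\<phi> x * (p x \<bullet> b))))"
      unfolding diff by (rule integral_mult_right_zero)
    finally show "(LINT x|lebesgue_on B. (u x)\<^sup>2 *\<^sub>R (D x * (\<phi> x * (p x \<bullet> b)))) = 0" by simp
  qed
  then have "AE x in lebesgue_on B. \<forall>b\<in>Basis. D x * (\<phi> x * (p x \<bullet> b)) = 0"
    by (subst AE_ball_countable) (auto simp: countable_finite)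
  moreover have "AE x in lebesgue_on B. d \<le> D x" by (rule AE_I2) (simp add: D(3))
  ultimately show ?thesis
  proof eventually_elim
    case (elim x)
    show ?case
    proof (rule euclidean_eqI)
      fix b :: 'a assume "b \<in> Basis"
      then have "D x * (\<phi> x * (p x \<bullet> b)) = 0" "D x \<noteq> 0" "\<phi> x \<noteq> 0"
        using elim d \<phi>(2)[of x] by auto
      then show "p x \<bullet> b = 0 \<bullet> b" by simp
    qed
  qed
qed

end

theorem theorem2p6:
  fixes \<Omega> B :: "(real ^ 'n) set" and D :: "real ^ 'n \<Rightarrow> real" and \<epsilon> d :: real
  assumes "is_domain \<Omega>" and "bounded \<Omega>" and "C1_boundary \<Omega>"
    and "is_domain B" and "bounded B" and "\<Omega> \<subset> B"
    and "\<epsilon> > 0"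
    and "D \<in> borel_measurable (lebesgue_on B)" and "bounded (D ` B)"
    and "d > 0" and "\<And>x. x \<in> B \<Longrightarrow> D x \<ge> d"
  defines "\<phi> \<equiv> phase_field \<Omega> \<epsilon>"
  shows "\<not> (\<forall>u\<in>H10 B. \<forall>v\<in>H10 B. dd_form B \<phi> D \<epsilon> u v = dd_form B \<phi> D \<epsilon> v u) \<and>
         (\<exists>C>0. \<forall>u\<in>H10 B. dd_form B \<phi> D \<epsilon> u u \<ge> C * dd_norm_sq B \<phi> \<epsilon> u)"
proof -
  have \<Omega>: "open \<Omega>" "\<Omega> \<noteq> {}" and dom_B: "open B" "B \<noteq> {}"
    using assms(1,4) by (auto simp: is_domain_def)
  obtain p P where grad: "p \<in> borel_measurable lebesgue"
    "\<And>S. open S \<Longrightarrow> has_weak_gradient S \<phi> p"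
    "AE x in lebesgue. norm (p x) \<le> P" "AE x in lebesgue. p x \<noteq> 0"
    using phase_field_gradient[OF \<Omega> assms(2,3,7)] unfolding \<phi>_def by metis
  obtain K where K: "\<forall>y\<in>D ` B. norm y \<le> K"
    using assms(9) unfolding bounded_iff ..
  interpret phase_field_form B \<phi> p D \<epsilon> P K d
  proof
    show "continuous_on UNIV \<phi>"
      unfolding \<phi>_def using phase_field_Lipschitz[OF assms(7)] by (rule Lipschitz_imp_continuous_on)
    show "0 < \<phi> x" "\<phi> x < 1" for x by (simp_all add: \<phi>_def phase_field_bounds)
    show "has_weak_gradient B \<phi> p" using dom_B(1) by (rule grad(2))
  qed (use dom_B assms grad(1,3) K in auto)
  have "\<not> (\<forall>u\<in>H10 B. \<forall>v\<in>H10 B. dd_form B \<phi> D \<epsilon> u v = dd_form B \<phi> D \<epsilon> v u)"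
  proof
    assume "\<forall>u\<in>H10 B. \<forall>v\<in>H10 B. dd_form B \<phi> D \<epsilon> u v = dd_form B \<phi> D \<epsilon> v u"
    then have "AE x in lebesgue. x \<in> B \<longrightarrow> p x = 0"
      using AE_gradient_zero_if_symmetric B_sets by (simp add: AE_restrict_space_iff)
    \<comment> \<open>\<open>p\<close> is nonzero almost everywhere in the whole space, so its
      vanishing on \<open>B\<close> would make \<open>B\<close> null, which a nonempty open set is
      not.\<close>
    with grad(4) have "AE x in lebesgue. x \<notin> B" by eventually_elim simp
    then have "negligible B"
      using B_sets by (simp add: negligible_iff_null_sets AE_iff_null_sets)
    then show False using open_not_negligible[OF dom_B] by simp
  qed
  moreover have "\<exists>C>0. \<forall>u\<in>H10 B. dd_form B \<phi> D \<epsilon> u u \<ge> C * dd_norm_sq B \<phi> \<epsilon> u"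
    using assms(10) coercive by (intro exI[of _ d]) simp
  ultimately show ?thesis ..
qed

end
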